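(* Let $f:[0,1]\to[0,1]$ be a $C^1$ map which is topologically mixing and countably Markov. Then $f$ is leo (locally eventually onto), and consequently $$\Lambda(f)=\exp h(f),$$ where $h(f)$ denotes the topological entropy of $f$.
   Context: For a continuous map $f:[0,1]\to[0,1]$, $\Lambda(f)$ is the infimum of all real $\lambda$ such that for some homeomorphism $\psi:[0,1]\to[0,1]$ the map $g=\psi\circ f\circ\psi^{-1}$ has Lipschitz constant $\lambda$, i.e. $|g(x)-g(y)|\le\lambda|x-y|$ for all $x,y\in[0,1]$ (the infimum of the empty set is $\infty$). $f$ is topologically mixing if for each pair of nonempty open sets $U,V\subset[0,1]$ there is $n_0\ge 0$ such that $f^n(U)\cap V\ne\emptyset$ for every $n\ge n_0$. $f$ is countably Markov if there is a closed, countable (possibly finite) set $P\subset[0,1]$ with $0,1\in P$, $f(P)\subset P$, and $f|_I$ monotone on each connected component $I$ of $[0,1]\setminus P$. $f$ is leo (locally eventually onto) if for every nonempty open set $U\subset[0,1]$ there is $n\in\mathbb N$ such that $f^n(U)=[0,1]$. *)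

theory Defs
  imports "HOL-Analysis.Analysis"
begin

text \<open>
  A map of the unit interval is represented by a function on the reals sending \<open>{0..1}\<close> into itself;
  no definition below depends on its values outside \<open>{0..1}\<close>. "Open" always means relatively open
  in \<open>{0..1}\<close>.
\<close>

text \<open>
  The derivative is taken within \<open>{0..1}\<close>, hence is one-sided at the endpoints
  (\<open>C1_differentiable_on\<close> would require two-sided derivatives there).
\<close>

definition C1_unit_interval :: "(real \<Rightarrow> real) \<Rightarrow> bool" where
  "C1_unit_interval f \<longleftrightarrow>
     (\<exists>f'. continuous_on {0..1} f' \<and>
        (\<forall>x\<in>{0..1}. (f has_real_derivative f' x) (at x within {0..1})))"

definition topologically_mixing :: "(real \<Rightarrow> real) \<Rightarrow> bool" where
  "topologically_mixing f \<longleftrightarrow>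
     (\<forall>U V. openin (top_of_set {0..1}) U \<and> U \<noteq> {} \<and> openin (top_of_set {0..1}) V \<and> V \<noteq> {} \<longrightarrow>
        (\<exists>n0. \<forall>n\<ge>n0. (f ^^ n) ` U \<inter> V \<noteq> {}))"

definition countably_Markov :: "(real \<Rightarrow> real) \<Rightarrow> bool" where
  "countably_Markov f \<longleftrightarrow>
     (\<exists>P. closed P \<and> countable P \<and> P \<subseteq> {0..1} \<and> 0 \<in> P \<and> 1 \<in> P \<and> f ` P \<subseteq> P \<and>
        (\<forall>I \<in> components ({0..1} - P). mono_on I f \<or> antimono_on I f))"

definition leo :: "(real \<Rightarrow> real) \<Rightarrow> bool" where
  "leo f \<longleftrightarrow>
     (\<forall>U. openin (top_of_set {0..1}) U \<and> U \<noteq> {} \<longrightarrow> (\<exists>n. (f ^^ n) ` U = {0..1}))"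

text \<open>
  \<open>lipschitz_on\<close> also demands a nonnegative constant, which is automatic for maps on \<open>{0..1}\<close>.
\<close>

definition Lip_inf :: "(real \<Rightarrow> real) \<Rightarrow> ereal" where
  "Lip_inf f = Inf {ereal L | L. \<exists>\<psi> \<psi>'. homeomorphism {0..1} {0..1::real} \<psi> \<psi>' \<and>
                                        L-lipschitz_on {0..1::real} (\<psi> \<circ> f \<circ> \<psi>')}"

definition separated_set :: "('a::metric_space \<Rightarrow> 'a) \<Rightarrow> nat \<Rightarrow> real \<Rightarrow> 'a set \<Rightarrow> bool" where
  "separated_set f n \<epsilon> E \<longleftrightarrow>
     (\<forall>x\<in>E. \<forall>y\<in>E. x \<noteq> y \<longrightarrow> (\<exists>i<n. dist ((f ^^ i) x) ((f ^^ i) y) > \<epsilon>))"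

text \<open>
  Topological entropy of \<open>f\<close> on a (nonempty, compact, invariant) set \<open>X\<close>, in the form of Bowen and
  Dinaburg: the limit as \<open>\<epsilon>\<close> tends to \<open>0\<close> of the upper exponential growth rate in \<open>n\<close> of the largest
  cardinality of an \<open>(n, \<epsilon>)\<close>-separated subset of \<open>X\<close>. The logarithm of the largest cardinality is
  written as the supremum of the logarithms, and, the growth rate being antitone in \<open>\<epsilon>\<close>, the limit
  is a supremum.
\<close>

definition topological_entropy :: "'a::metric_space set \<Rightarrow> ('a \<Rightarrow> 'a) \<Rightarrow> ereal" where
  "topological_entropy X f =
     (SUP \<epsilon>\<in>{0<..}. limsup (\<lambda>n.
        SUP E\<in>{E. finite E \<and> E \<noteq> {} \<and> E \<subseteq> X \<and> separated_set f n \<epsilon> E}.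
          ereal (ln (real (card E)) / real n)))"

fun exp_ereal :: "ereal \<Rightarrow> ereal" where
  "exp_ereal (ereal r) = ereal (exp r)"
| "exp_ereal PInfty = \<infinity>"
| "exp_ereal MInfty = 0"

end

theory Submission
  imports Defs
begin

text \<open>
  A mixing map is leo as soon as orbits of interior points reach both endpoints. An endpoint out of
  reach is fixed by \<open>f\<close> or \<open>f\<^sup>2\<close> and has no other preimage under that map. For a \<open>C\<^sup>1\<close> map it then either
  attracts or, the map being monotone nearby, repels a whole interval; both contradict mixing.

  For the entropy formula let \<open>(a, b)\<close> be a complementary interval of the Markov set \<open>P\<close>. Every point
  of \<open>f\<^sup>-\<^sup>n(y)\<close> with \<open>y\<close> in \<open>(a, b)\<close> sits on a branch that \<open>f\<^sup>n\<close> maps bijectively onto \<open>(a, b)\<close>, and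
  for a leo map some iterate \<open>f\<^sup>k\<close> of \<open>(a, b)\<close> covers all these branches. This is a horseshoe, so
  the number of preimages satisfies \<open>#f\<^sup>-\<^sup>n(y) \<le> exp ((n + k) h)\<close>, with \<open>k\<close> independent of \<open>n\<close> and \<open>y\<close>.
  Hence for \<open>\<lambda> > exp h\<close> the series of terms \<open>\<lambda>\<^sup>-\<^sup>n \<integral> #(f\<^sup>-\<^sup>n(y) \<inter> [0, x]) dy\<close>, with \<open>y\<close> ranging over \<open>(a, b)\<close>,
  converges. Up to a constant factor its sum is a homeomorphism \<open>\<psi>(x)\<close>, and \<open>f\<close> is \<open>\<lambda>\<close>-Lipschitz in this
  coordinate since a point of \<open>f\<^sup>-\<^sup>n(y)\<close> in \<open>f(A)\<close> comes from a point of \<open>f\<^sup>-\<^sup>n\<^sup>-\<^sup>1(y)\<close> in \<open>A\<close>.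
\<close>

section \<open>Fibre counts and their integrals\<close>

lemma funpow_in: "f ` X \<subseteq> X \<Longrightarrow> x \<in> X \<Longrightarrow> (f ^^ n) x \<in> X"
  by (induction n) auto

lemma continuous_on_funpow:
  assumes "continuous_on X f" "f ` X \<subseteq> X"
  shows "continuous_on X (f ^^ n)"
proof (induction n)
  case (Suc n)
  have "(f ^^ n) ` X \<subseteq> X" using funpow_in[OF assms(2)] by blast
  then show ?case
    using Suc continuous_on_compose continuous_on_subset[OF assms(1)] by (metis funpow.simps(2))
qed (simp add: id_def)

definition fibre_count :: "('a \<Rightarrow> 'b) \<Rightarrow> 'a set \<Rightarrow> 'b \<Rightarrow> nat" where
  "fibre_count F A y = card {z \<in> A. F z = y}"

lemma fibre_count_measurable:
  fixes F :: "real \<Rightarrow> real"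
  assumes F: "continuous_on {0..1} F" and A: "is_interval A" "A \<subseteq> {0..1}"
    and fin: "\<And>y. y \<in> B \<Longrightarrow> finite {z \<in> {0..1}. F z = y}"
  shows "(\<lambda>y. real (fibre_count F A y)) \<in> borel_measurable (restrict_space lborel B)"
proof -
  \<comment> \<open>For large \<open>k\<close> the points of a finite fibre lie in different cells of length \<open>1 / (k + 1)\<close>,
    so counting the cells they meet counts the points.\<close>
  define C where "C k i = A \<inter> {real i / real (Suc k) ..< (real i + 1) / real (Suc k)}" for k i
  \<comment> \<open>Indices run up to \<open>Suc k\<close> inclusive because the point 1 lies in the
    cell with index \<open>Suc k\<close>; every other point of \<open>A\<close> lies in an earlier
    cell.\<close>
  define u :: "nat \<Rightarrow> real \<Rightarrow> real" where "u k y = (\<Sum>i\<le>Suc k. indicator (F ` C k i) y)" for k y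
  have C_iff: "z \<in> C k i \<longleftrightarrow> z \<in> A \<and> \<lfloor>z * real (Suc k)\<rfloor> = int i" for z k i
    unfolding C_def floor_eq_iff by (auto simp: field_simps)
  have "F ` C k i \<in> sets borel" for k i
  proof -
    have "is_interval (C k i)"
      unfolding C_def by (intro is_interval_Int A) (simp add: is_interval_co)
    then have "connected (F ` C k i)"
      using A by (intro connected_continuous_image continuous_on_subset[OF F])
        (auto simp: C_def is_interval_connected)
    then show ?thesis by (intro real_interval_borel_measurable) (simp add: is_interval_connected_1)
  qed
  then have u: "u k \<in> borel_measurable (restrict_space lborel B)" for k
    unfolding u_def by (intro borel_measurable_sum measurable_restrict_space1 borel_measurable_indicator) auto
  show ?thesis
  proof (rule borel_measurable_LIMSEQ_real[OF _ u])
    fix y assume "y \<in> space (restrict_space lborel B)"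
    then have "finite {z \<in> {0..1}. F z = y}" using fin by (auto simp: space_restrict_space)
    define S where "S = {z \<in> A. F z = y}"
    have S: "finite S" using \<open>finite {z \<in> {0..1}. F z = y}\<close> A unfolding S_def
      by (rule_tac finite_subset) auto
    have uS: "u k y = real (card ((\<lambda>z. \<lfloor>z * real (Suc k)\<rfloor>) ` S))" for k
    proof -
      have "u k y = real (card {i. i \<le> Suc k \<and> y \<in> F ` C k i})"
        unfolding u_def indicator_def
        by (simp add: sum.If_cases Int_def del: sum.atMost_Suc)
      also have "{i. i \<le> Suc k \<and> y \<in> F ` C k i} = nat ` (\<lambda>z. \<lfloor>z * real (Suc k)\<rfloor>) ` S"
      proof (intro equalityI subsetI)
        fix i assume "i \<in> {i. i \<le> Suc k \<and> y \<in> F ` C k i}"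
        then obtain z where "z \<in> C k i" "F z = y" by auto
        then show "i \<in> nat ` (\<lambda>z. \<lfloor>z * real (Suc k)\<rfloor>) ` S"
          using C_iff unfolding S_def by (auto simp: image_iff intro!: exI[of _ z])
      next
        fix i assume "i \<in> nat ` (\<lambda>z. \<lfloor>z * real (Suc k)\<rfloor>) ` S"
        then obtain z where i: "i = nat \<lfloor>z * real (Suc k)\<rfloor>" and "z \<in> S" by auto
        then have z: "z \<in> A" "F z = y" "0 \<le> z" "z \<le> 1" using A S_def by auto
        have "z * real (Suc k) \<le> 1 * real (Suc k)" using z by (intro mult_right_mono) auto
        then have "\<lfloor>z * real (Suc k)\<rfloor> \<le> int (Suc k)"
          using floor_mono by (metis floor_of_nat mult_1)
        moreover have "0 \<le> \<lfloor>z * real (Suc k)\<rfloor>" using z by simp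
        then have "z \<in> C k i" using C_iff z i by simp
        ultimately show "i \<in> {i. i \<le> Suc k \<and> y \<in> F ` C k i}" using z i by auto
      qed
      also have "card \<dots> = card ((\<lambda>z. \<lfloor>z * real (Suc k)\<rfloor>) ` S)"
      proof (rule card_image, rule inj_onI)
        fix p q assume "p \<in> (\<lambda>z. \<lfloor>z * real (Suc k)\<rfloor>) ` S" "q \<in> (\<lambda>z. \<lfloor>z * real (Suc k)\<rfloor>) ` S"
          and e: "nat p = nat q"
        then have "0 \<le> p" "0 \<le> q" using A by (auto simp: S_def)
        with e show "p = q" by simp
      qed
      finally show ?thesis .
    qed
    obtain d where d: "d > 0" "\<And>z z'. z \<in> S \<Longrightarrow> z' \<in> S \<Longrightarrow> z \<noteq> z' \<Longrightarrow> d \<le> \<bar>z - z'\<bar>"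
    proof -
      \<comment> \<open>The inserted 1 keeps \<open>?D\<close> nonempty when \<open>S\<close> has at
        most one point.\<close>
      let ?D = "insert 1 ((\<lambda>(z, z'). \<bar>z - z'\<bar>) ` {p \<in> S \<times> S. fst p \<noteq> snd p})"
      have "finite ?D" using S by auto
      moreover have "0 < Min ?D" using S by (subst Min_gr_iff) auto
      ultimately show ?thesis
        by (intro that[of "Min ?D"]) (auto intro!: Min_le)
    qed
    obtain K :: nat where K: "1 / d < K" using reals_Archimedean2 by blast
    have "u k y = real (fibre_count F A y)" if "k \<ge> K" for k
    proof -
      have "inj_on (\<lambda>z. \<lfloor>z * real (Suc k)\<rfloor>) S"
      proof (rule inj_onI, rule ccontr)
        fix z z' assume z: "z \<in> S" "z' \<in> S" "\<lfloor>z * real (Suc k)\<rfloor> = \<lfloor>z' * real (Suc k)\<rfloor>" "z \<noteq> z'"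
        have "1 < d * real (Suc k)" using K that d(1) by (simp add: field_simps) (smt (verit) mult_left_mono of_nat_mono)
        also have "\<dots> \<le> \<bar>z - z'\<bar> * real (Suc k)" using d z by (intro mult_right_mono) auto
        also have "\<dots> = \<bar>z * real (Suc k) - z' * real (Suc k)\<bar>"
          by (simp only: left_diff_distrib[symmetric] abs_mult abs_of_nat)
        finally show False using z(3) by linarith
      qed
      then show ?thesis unfolding uS fibre_count_def S_def[symmetric] by (simp add: card_image)
    qed
    then show "(\<lambda>k. u k y) \<longlonglongrightarrow> real (fibre_count F A y)"
      by (intro tendsto_eventually eventually_sequentiallyI)
  qed
qed

text \<open>Used with \<open>F = f ^^ n\<close> for each \<open>n\<close>. The constant
  \<open>N\<close> dominates every fibre count, which gives integrability and permits dominated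
  convergence.\<close>

locale bounded_fibres =
  fixes F :: "real \<Rightarrow> real" and a b N :: real
  assumes cont: "continuous_on {0..1} F"
    and ab: "a < b"
    and fin: "\<And>y. y \<in> {a<..<b} \<Longrightarrow> finite {z \<in> {0..1}. F z = y}"
    and bound: "\<And>y. y \<in> {a<..<b} \<Longrightarrow> real (fibre_count F {0..1} y) \<le> N"
begin

text \<open>Off \<open>(a, b)\<close> a fibre may be infinite, in which case \<open>fibre_count\<close> is 0.\<close>

abbreviation "M \<equiv> restrict_space lborel {a<..<b}"

text \<open>For a closed interval \<open>A\<close> this is an integral of the Banach indicatrix: the
  total variation over \<open>A\<close> of \<open>F\<close> truncated to values between
  \<open>a\<close> and \<open>b\<close>.\<close>

definition fibre_mass :: "real set \<Rightarrow> real" where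
  "fibre_mass A = (\<integral>y. real (fibre_count F A y) \<partial>M)"

lemma finite_measure_M: "finite_measure M"
  by (intro finite_measureI) (auto simp: emeasure_restrict_space space_restrict_space ab less_imp_le)

lemma measure_M: "measure M (space M) = b - a"
  using ab by (simp add: measure_restrict_space space_restrict_space)

lemma AE_M_neq: "AE y in M. y \<noteq> c"
  by (subst AE_restrict_space_iff) (auto intro: AE_mp[OF AE_lborel_singleton[of c]])

lemma count_mono:
  assumes "A \<subseteq> B" "B \<subseteq> {0..1}" "y \<in> {a<..<b}"
  shows "fibre_count F A y \<le> fibre_count F B y"
proof -
  have "finite {z \<in> B. F z = y}"
    by (rule finite_subset[OF _ fin[OF assms(3)]]) (use assms in auto)
  then show ?thesis unfolding fibre_count_def by (rule card_mono) (use assms in auto)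
qed

lemma integrable_count:
  assumes "is_interval A" "A \<subseteq> {0..1}"
  shows "integrable M (\<lambda>y. real (fibre_count F A y))"
proof (rule finite_measure.integrable_const_bound[OF finite_measure_M])
  show "AE y in M. norm (real (fibre_count F A y)) \<le> N"
  proof (rule AE_I2)
    fix y assume "y \<in> space M"
    then have y: "y \<in> {a<..<b}" by (simp add: space_restrict_space)
    then show "norm (real (fibre_count F A y)) \<le> N"
      using bound[OF y] count_mono[OF assms(2) order_refl y] by simp
  qed
  show "(\<lambda>y. real (fibre_count F A y)) \<in> borel_measurable M"
    using fibre_count_measurable[OF cont assms fin] .
qed

lemma fibre_mass_nonneg: "0 \<le> fibre_mass A"
  unfolding fibre_mass_def by (intro integral_nonneg_AE) simp

lemma fibre_mass_le:
  assumes "is_interval A" "A \<subseteq> {0..1}"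
  shows "fibre_mass A \<le> N * (b - a)"
proof -
  have "fibre_mass A \<le> (\<integral>y. N \<partial>M)" unfolding fibre_mass_def
  proof (rule integral_mono)
    show "integrable M (\<lambda>y. real (fibre_count F A y))" using integrable_count assms .
    show "integrable M (\<lambda>y. N)" using finite_measure.integrable_const[OF finite_measure_M] .
    fix y assume "y \<in> space M"
    then have y: "y \<in> {a<..<b}" by (simp add: space_restrict_space)
    then show "real (fibre_count F A y) \<le> N"
      using bound[OF y] count_mono[OF assms(2) order_refl y] by simp
  qed
  also have "\<dots> = N * (b - a)" using measure_M by simp
  finally show ?thesis .
qed

lemma fibre_mass_ge:
  assumes "is_interval A" "A \<subseteq> {0..1}" "{a<..<b} \<subseteq> F ` A"
  shows "b - a \<le> fibre_mass A"
proof -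
  have "b - a = (\<integral>y. 1 \<partial>M)" using measure_M by simp
  also have "\<dots> \<le> fibre_mass A" unfolding fibre_mass_def
  proof (rule integral_mono)
    show "integrable M (\<lambda>y. real (fibre_count F A y))" using integrable_count assms by blast
    show "integrable M (\<lambda>y. 1::real)" using finite_measure.integrable_const[OF finite_measure_M] .
    fix y assume "y \<in> space M"
    then have y: "y \<in> {a<..<b}" by (simp add: space_restrict_space)
    have "finite {z \<in> A. F z = y}" by (rule finite_subset[OF _ fin[OF y]]) (use assms in auto)
    moreover have "{z \<in> A. F z = y} \<noteq> {}" using assms(3) y by blast
    ultimately have "0 < fibre_count F A y" unfolding fibre_count_def by (simp add: card_gt_0_iff)
    then show "1 \<le> real (fibre_count F A y)" by simp
  qed
  finally show ?thesis .
qed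

text \<open>A preimage at the common point \<open>x\<close> is counted on both sides, but this
  concerns only the single value \<open>y = F x\<close>, which is a null set.\<close>

lemma fibre_mass_split:
  assumes "0 \<le> x" "x \<le> x'" "x' \<le> 1"
  shows "fibre_mass {0..x'} = fibre_mass {0..x} + fibre_mass {x..x'}"
proof -
  have "fibre_mass {0..x} + fibre_mass {x..x'} =
      (\<integral>y. real (fibre_count F {0..x} y) + real (fibre_count F {x..x'} y) \<partial>M)"
    unfolding fibre_mass_def
    by (rule Bochner_Integration.integral_add[symmetric]; rule integrable_count)
       (use assms in \<open>auto simp: is_interval_cc\<close>)
  also have "\<dots> = fibre_mass {0..x'}" unfolding fibre_mass_def
  proof (rule integral_cong_AE)
    have *: "(\<lambda>y. real (fibre_count F {p..q} y)) \<in> borel_measurable M" if "0 \<le> p" "q \<le> 1" for p q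
      by (rule fibre_count_measurable[OF cont _ _ fin]) (use that in \<open>auto simp: is_interval_cc\<close>)
    show "(\<lambda>y. real (fibre_count F {0..x} y) + real (fibre_count F {x..x'} y)) \<in> borel_measurable M"
      "(\<lambda>y. real (fibre_count F {0..x'} y)) \<in> borel_measurable M"
      using assms by (auto intro!: borel_measurable_add *)
    show "AE y in M. real (fibre_count F {0..x} y) + real (fibre_count F {x..x'} y)
        = real (fibre_count F {0..x'} y)"
    proof (rule AE_mp[OF AE_M_neq[of "F x"]], rule AE_I2, rule impI)
      fix y assume "y \<in> space M" and ne: "y \<noteq> F x"
      then have y: "y \<in> {a<..<b}" by (simp add: space_restrict_space)
      have "{z \<in> {0..x'}. F z = y} = {z \<in> {0..x}. F z = y} \<union> {z \<in> {x..x'}. F z = y}"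
        using assms by auto
      moreover have "card ({z \<in> {0..x}. F z = y} \<union> {z \<in> {x..x'}. F z = y})
          = card {z \<in> {0..x}. F z = y} + card {z \<in> {x..x'}. F z = y}"
      proof (rule card_Un_disjoint)
        show "finite {z \<in> {0..x}. F z = y}" "finite {z \<in> {x..x'}. F z = y}"
          by (rule finite_subset[OF _ fin[OF y]]; use assms in auto)+
        show "{z \<in> {0..x}. F z = y} \<inter> {z \<in> {x..x'}. F z = y} = {}"
          using ne by force
      qed
      ultimately show "real (fibre_count F {0..x} y) + real (fibre_count F {x..x'} y)
        = real (fibre_count F {0..x'} y)" unfolding fibre_count_def by simp
    qed
  qed
  finally show ?thesis by simp
qed

lemma fibre_mass_0: "fibre_mass {0..0} = 0"
  using fibre_mass_split[of 0 0] by simp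

text \<open>For \<open>y\<close> other than \<open>F l\<close> the finite fibre keeps a positive
  distance from \<open>l\<close>, so the count over \<open>{0..x n}\<close> is eventually constant.
  Dominated convergence then handles the integral.\<close>

lemma continuous_fibre_mass: "continuous_on {0..1} (\<lambda>x. fibre_mass {0..x})"
  unfolding continuous_on_sequentially o_def
proof (intro allI ballI impI, elim conjE)
  fix x :: "nat \<Rightarrow> real" and l
  assume l: "l \<in> {0..1}" and "\<forall>n. x n \<in> {0..1}" and lim: "x \<longlonglongrightarrow> l"
  then have x: "0 \<le> x n" "x n \<le> 1" for n by auto
  have meas: "(\<lambda>y. real (fibre_count F {0..q} y)) \<in> borel_measurable M" if "q \<le> 1" for q
    by (rule fibre_count_measurable[OF cont _ _ fin]) (use that in \<open>auto simp: is_interval_cc\<close>)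
  show "(\<lambda>n. fibre_mass {0..x n}) \<longlonglongrightarrow> fibre_mass {0..l}"
    unfolding fibre_mass_def
  proof (rule integral_dominated_convergence[where w = "\<lambda>_. N"])
    show "integrable M (\<lambda>y. N)" using finite_measure.integrable_const[OF finite_measure_M] .
    show "AE y in M. norm (real (fibre_count F {0..x n} y)) \<le> N" for n
    proof (rule AE_I2)
      fix y assume "y \<in> space M"
      then have y: "y \<in> {a<..<b}" by (simp add: space_restrict_space)
      then show "norm (real (fibre_count F {0..x n} y)) \<le> N"
        using bound[OF y] count_mono[of "{0..x n}" "{0..1}" y] x[of n] by simp
    qed
    show "AE y in M. (\<lambda>n. real (fibre_count F {0..x n} y)) \<longlonglongrightarrow> real (fibre_count F {0..l} y)"
    proof (rule AE_mp[OF AE_M_neq[of "F l"]], rule AE_I2, rule impI)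
      fix y assume "y \<in> space M" and ne: "y \<noteq> F l"
      then have y: "y \<in> {a<..<b}" by (simp add: space_restrict_space)
      let ?S = "{z \<in> {0..1}. F z = y}"
      have "closed ?S" using fin[OF y] finite_imp_closed by blast
      moreover have "l \<notin> ?S" using ne by auto
      ultimately obtain d where d: "d > 0" "\<And>z. z \<in> ?S \<Longrightarrow> d \<le> dist l z"
        using separate_point_closed[of ?S l] by blast
      have "\<forall>\<^sub>F n in sequentially. dist (x n) l < d" using lim d(1) by (simp add: tendsto_iff)
      then have "\<forall>\<^sub>F n in sequentially. real (fibre_count F {0..x n} y) = real (fibre_count F {0..l} y)"
      proof eventually_elim
        case (elim n)
        have "{z \<in> {0..x n}. F z = y} = {z \<in> {0..l}. F z = y}"
        proof -
          have "z \<le> x n \<longleftrightarrow> z \<le> l" if "z \<in> ?S" for z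
            using d(2)[OF that] elim by (auto simp: dist_real_def)
          then show ?thesis using x[of n] l by fastforce
        qed
        then show ?case by (simp add: fibre_count_def)
      qed
      then show "(\<lambda>n. real (fibre_count F {0..x n} y)) \<longlonglongrightarrow> real (fibre_count F {0..l} y)"
        by (rule tendsto_eventually)
    qed
  qed (use meas x l in auto)
qed

end

section \<open>The weighted series of fibre masses as a Lipschitz coordinate\<close>

lemma fibre_mass_image_le:
  assumes f: "f ` {0..1} \<subseteq> {0..1}"
    and n: "bounded_fibres (f ^^ n) a b N" and Sn: "bounded_fibres (f ^^ Suc n) a b N'"
    and x: "0 \<le> x" "x \<le> x'" "x' \<le> 1" and pq: "{p..q} \<subseteq> f ` {x..x'}"
  shows "bounded_fibres.fibre_mass (f ^^ n) a b {p..q}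
      \<le> bounded_fibres.fibre_mass (f ^^ Suc n) a b {x..x'}"
proof -
  have xx': "{x..x'} \<subseteq> {0..1}" using x by auto
  then have pq': "{p..q} \<subseteq> {0..1}"
    by (intro subset_trans[OF pq subset_trans[OF image_mono f]])
  show ?thesis
    unfolding bounded_fibres.fibre_mass_def[OF n] bounded_fibres.fibre_mass_def[OF Sn]
  proof (rule integral_mono)
    fix y assume "y \<in> space (restrict_space lborel {a<..<b})"
    then have y: "y \<in> {a<..<b}" by (simp add: space_restrict_space)
    \<comment> \<open>Every \<open>z\<close> in \<open>{p..q}\<close> has an
      \<open>f\<close>-preimage in \<open>{x..x'}\<close>, so \<open>f\<close> maps the fibre of
      \<open>f ^^ Suc n\<close> over all points counted for \<open>f ^^ n\<close>. This shift of the
      exponent later produces the factor \<open>lam\<close>.\<close>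
    have "{z \<in> {p..q}. (f ^^ n) z = y} \<subseteq> f ` {w \<in> {x..x'}. (f ^^ Suc n) w = y}"
    proof
      fix z assume z: "z \<in> {z \<in> {p..q}. (f ^^ n) z = y}"
      then obtain w where "w \<in> {x..x'}" "z = f w" using pq by blast
      then show "z \<in> f ` {w \<in> {x..x'}. (f ^^ Suc n) w = y}"
        using z by (auto simp del: funpow.simps simp: funpow_Suc_right)
    qed
    moreover have "finite {w \<in> {x..x'}. (f ^^ Suc n) w = y}"
      by (rule finite_subset[OF _ bounded_fibres.fin[OF Sn y]]) (use x in auto)
    ultimately show "real (fibre_count (f ^^ n) {p..q} y) \<le> real (fibre_count (f ^^ Suc n) {x..x'} y)"
      unfolding fibre_count_def by (simp only: of_nat_le_iff) (rule surj_card_le)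
  qed (intro bounded_fibres.integrable_count[OF n] bounded_fibres.integrable_count[OF Sn]
      is_interval_cc xx' pq')+
qed

text \<open>The coordinate is \<open>S\<close>, the sum of the masses of \<open>{0..x}\<close> with
  weights \<open>1 / lam ^ n\<close>, normalised by \<open>S 1\<close>. Summability makes
  \<open>S\<close> finite and continuous, \<open>cover\<close> makes it strictly increasing, and the
  shift of \<open>n\<close> under \<open>f\<close> bounds the stretching by \<open>lam\<close>.
  Entropy and Markov structure enter only through the bounds \<open>N n\<close>.\<close>

lemma lipschitz_conjugate:
  fixes f :: "real \<Rightarrow> real"
  assumes cont: "continuous_on {0..1} f" and self: "f ` {0..1} \<subseteq> {0..1}" and ab: "a < b"
    and fin: "\<And>n y. y \<in> {a<..<b} \<Longrightarrow> finite {z \<in> {0..1}. (f ^^ n) z = y}"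
    and bound: "\<And>n y. y \<in> {a<..<b} \<Longrightarrow> real (fibre_count (f ^^ n) {0..1} y) \<le> N n"
    and lam: "lam > 0" "summable (\<lambda>n. N n / lam ^ n)"
    and cover: "\<And>x x'. 0 \<le> x \<Longrightarrow> x < x' \<Longrightarrow> x' \<le> 1 \<Longrightarrow> \<exists>n. {a<..<b} \<subseteq> (f ^^ n) ` {x..x'}"
  shows "\<exists>\<psi> \<psi>'. homeomorphism {0..1} {0..1::real} \<psi> \<psi>' \<and> lam-lipschitz_on {0..1::real} (\<psi> \<circ> f \<circ> \<psi>')"
proof -
  have B: "bounded_fibres (f ^^ n) a b (N n)" for n
    by unfold_locales (use continuous_on_funpow[OF cont self] ab fin bound in auto)
  define m where "m n A = bounded_fibres.fibre_mass (f ^^ n) a b A" for n A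
  note m = bounded_fibres.fibre_mass_nonneg[OF B, folded m_def]
    bounded_fibres.fibre_mass_le[OF B, folded m_def]
    bounded_fibres.fibre_mass_ge[OF B, folded m_def]
    bounded_fibres.fibre_mass_split[OF B, folded m_def]
    bounded_fibres.fibre_mass_0[OF B, folded m_def]
    bounded_fibres.continuous_fibre_mass[OF B, folded m_def]
    fibre_mass_image_le[OF self B B, folded m_def]
  have norm_le: "norm (m n {p..q} / lam ^ n) \<le> N n * (b - a) / lam ^ n" if "0 \<le> p" "q \<le> 1" for n p q
    using m(1)[of n "{p..q}"] m(2)[of "{p..q}" n] that lam(1)
    by (auto simp: is_interval_cc intro!: divide_right_mono)
  have sum_b: "summable (\<lambda>n. N n * (b - a) / lam ^ n)"
    using summable_mult2[OF lam(2), of "b - a"] by simp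
  have summ: "summable (\<lambda>n. m n {p..q} / lam ^ n)" if "0 \<le> p" "q \<le> 1" for p q
    by (rule summable_comparison_test'[OF sum_b norm_le[OF that]])
  define S where "S x = (\<Sum>n. m n {0..x} / lam ^ n)" for x
  have diff: "S x' - S x = (\<Sum>n. m n {x..x'} / lam ^ n)" if "0 \<le> x" "x \<le> x'" "x' \<le> 1" for x x'
  proof -
    have "S x' = (\<Sum>n. m n {0..x} / lam ^ n + m n {x..x'} / lam ^ n)"
      unfolding S_def m(4)[OF that] by (simp add: add_divide_distrib)
    also have "\<dots> = S x + (\<Sum>n. m n {x..x'} / lam ^ n)"
      unfolding S_def using that by (intro suminf_add[symmetric] summ) auto
    finally show ?thesis by simp
  qed
  have less: "S x < S x'" if x: "0 \<le> x" "x < x'" "x' \<le> 1" for x x'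
  proof -
    \<comment> \<open>A single iterate of \<open>{x..x'}\<close> covering \<open>(a, b)\<close>
      makes one term of the series at least \<open>(b - a) / lam ^ n\<close>; the other terms are
      nonnegative.\<close>
    obtain n where n: "{a<..<b} \<subseteq> (f ^^ n) ` {x..x'}" using cover[OF x] by blast
    then have "0 < m n {x..x'} / lam ^ n"
      using m(3)[of "{x..x'}" n] x ab lam(1) by (simp add: is_interval_cc)
    then have "0 < (\<Sum>n. m n {x..x'} / lam ^ n)"
    proof (rule suminf_pos2[rotated 2])
      show "summable (\<lambda>n. m n {x..x'} / lam ^ n)" using summ x by simp
      show "0 \<le> m k {x..x'} / lam ^ k" for k
        using m(1)[of k "{x..x'}"] lam(1) by simp
    qed
    then show ?thesis using diff[of x x'] x by simp
  qed
  have step: "S q - S p \<le> lam * (S x' - S x)"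
    if x: "0 \<le> x" "x \<le> x'" "x' \<le> 1" and pq: "p \<le> q" "{p..q} \<subseteq> f ` {x..x'}" for p q x x'
  proof -
    have "{x..x'} \<subseteq> {0..1}" using x by auto
    then have "{p..q} \<subseteq> {0..1}"
      by (intro subset_trans[OF pq(2) subset_trans[OF image_mono self]])
    then have pq': "0 \<le> p" "q \<le> 1" using pq(1) by auto
    have sx: "summable (\<lambda>n. m n {x..x'} / lam ^ n)" using summ x by simp
    have sSx: "summable (\<lambda>n. m (Suc n) {x..x'} / lam ^ Suc n)"
      using sx by (subst summable_Suc_iff)
    have "S q - S p = (\<Sum>n. m n {p..q} / lam ^ n)" using diff pq pq' by simp
    also have "\<dots> \<le> (\<Sum>n. lam * (m (Suc n) {x..x'} / lam ^ Suc n))"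
    proof (rule suminf_le)
      show "m n {p..q} / lam ^ n \<le> lam * (m (Suc n) {x..x'} / lam ^ Suc n)" for n
        using m(7)[OF x pq(2), of n] lam(1) by (simp add: field_simps)
      show "summable (\<lambda>n. m n {p..q} / lam ^ n)" using summ pq' by simp
      show "summable (\<lambda>n. lam * (m (Suc n) {x..x'} / lam ^ Suc n))" using sSx by (rule summable_mult)
    qed
    also have "\<dots> = lam * (\<Sum>n. m (Suc n) {x..x'} / lam ^ Suc n)"
      by (rule suminf_mult[OF sSx])
    \<comment> \<open>The shifted series is the full one without its term of index 0, which is
      nonnegative and can be restored at the cost of an inequality.\<close>
    also have "\<dots> = lam * ((\<Sum>n. m n {x..x'} / lam ^ n) - m 0 {x..x'})"
      using suminf_split_head[OF sx] by simp
    also have "\<dots> \<le> lam * (\<Sum>n. m n {x..x'} / lam ^ n)"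
      using lam(1) m(1)[of 0 "{x..x'}"] by (intro mult_left_mono) auto
    finally show ?thesis using diff x by simp
  qed
  have "continuous_on {0..1} (\<lambda>x. \<Sum>i<n. m i {0..x} / lam ^ i)" for n
    using lam(1) by (intro continuous_intros m(6)) auto
  then have contS: "continuous_on {0..1} S"
    unfolding S_def
  proof (intro uniform_limit_theorem[OF _ Weierstrass_m_test[OF _ sum_b]] always_eventually allI)
    show "norm (m n {0..x} / lam ^ n) \<le> N n * (b - a) / lam ^ n" if "x \<in> {0..1}" for n x
      using that by (intro norm_le) auto
  qed auto
  have S0: "S 0 = 0" unfolding S_def using m(5) by simp
  have S1: "0 < S 1" using less[of 0 1] S0 by simp
  define \<psi> where "\<psi> x = S x / S 1" for x
  have \<psi>_less: "\<psi> x < \<psi> x'" if "0 \<le> x" "x < x'" "x' \<le> 1" for x x'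
    unfolding \<psi>_def using less[OF that] S1 by (simp add: divide_strict_right_mono)
  have \<psi>_cont: "continuous_on {0..1} \<psi>" unfolding \<psi>_def using S1 by (intro continuous_intros contS) auto
  have \<psi>01: "\<psi> 0 = 0" "\<psi> 1 = 1" using S0 S1 unfolding \<psi>_def by auto
  have "\<psi> ` {0..1} = {0..1}"
  proof
    show "\<psi> ` {0..1} \<subseteq> {0..1}"
    proof clarify
      fix x :: real assume "x \<in> {0..1}"
      then show "\<psi> x \<in> {0..1}"
        using \<psi>_less[of 0 x] \<psi>_less[of x 1] \<psi>01 by (cases "x = 0"; cases "x = 1") auto
    qed
    show "{0..1} \<subseteq> \<psi> ` {0..1}"
    proof
      fix y :: real assume "y \<in> {0..1}"
      then obtain x where "0 \<le> x" "x \<le> 1" "\<psi> x = y"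
        using IVT'[of \<psi> 0 y 1] \<psi>_cont \<psi>01 by auto
      then show "y \<in> \<psi> ` {0..1}" by auto
    qed
  qed
  moreover have "inj_on \<psi> {0..1}"
    by (rule linorder_inj_onI) (use \<psi>_less in \<open>fastforce+\<close>)
  ultimately obtain \<psi>' where hom: "homeomorphism {0..1} {0..1} \<psi> \<psi>'"
    using homeomorphism_compact[of "{0..1}" \<psi> "{0..1}"] \<psi>_cont by auto
  have key: "\<bar>\<psi> (f x) - \<psi> (f x')\<bar> \<le> lam * (\<psi> x' - \<psi> x)" if x: "0 \<le> x" "x \<le> x'" "x' \<le> 1" for x x'
  proof -
    have conn: "connected (f ` {x..x'})"
      by (intro connected_continuous_image continuous_on_subset[OF cont]) (use x in auto)
    \<comment> \<open>One of these intervals is empty unless the two values agree; both are recorded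
      so that \<open>step\<close> applies whichever value is larger.\<close>
    have sub: "{f x..f x'} \<subseteq> f ` {x..x'}" "{f x'..f x} \<subseteq> f ` {x..x'}"
      by (rule connected_contains_Icc[OF conn]; use x in auto)+
    have "\<bar>S (f x) - S (f x')\<bar> \<le> lam * (S x' - S x)"
    proof -
      have fx: "f x \<in> {0..1}" "f x' \<in> {0..1}" 
        by (rule subsetD[OF self imageI]; use x in simp)+
      consider "f x < f x'" | "f x = f x'" | "f x' < f x" by linarith
      then show ?thesis
        using step[OF x _ sub(1)] step[OF x _ sub(2)] less[of "f x" "f x'"] less[of "f x'" "f x"] fx
        by cases auto
    qed
    then have "\<bar>S (f x) - S (f x')\<bar> / S 1 \<le> lam * (S x' - S x) / S 1"
      using S1 by (intro divide_right_mono) auto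
    then show ?thesis unfolding \<psi>_def using S1 by (simp add: diff_divide_distrib[symmetric])
  qed
  have "lam-lipschitz_on {0..1} (\<psi> \<circ> f \<circ> \<psi>')"
  proof (rule lipschitz_onI)
    fix u v :: real assume uv: "u \<in> {0..1}" "v \<in> {0..1}"
    define x y where "x = \<psi>' u" and "y = \<psi>' v"
    have xy: "x \<in> {0..1}" "y \<in> {0..1}" "\<psi> x = u" "\<psi> y = v"
      using hom uv unfolding homeomorphism_def x_def y_def by auto
    have "\<bar>\<psi> (f x) - \<psi> (f y)\<bar> \<le> lam * \<bar>\<psi> x - \<psi> y\<bar>"
    proof (cases "x \<le> y")
      case True
      then have "\<bar>\<psi> (f x) - \<psi> (f y)\<bar> \<le> lam * (\<psi> y - \<psi> x)" using key[of x y] xy by auto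
      also have "\<dots> \<le> lam * \<bar>\<psi> x - \<psi> y\<bar>" using lam(1) by (intro mult_left_mono) auto
      finally show ?thesis .
    next
      case False
      then have "\<bar>\<psi> (f y) - \<psi> (f x)\<bar> \<le> lam * (\<psi> x - \<psi> y)" using key[of y x] xy by auto
      also have "\<dots> \<le> lam * \<bar>\<psi> x - \<psi> y\<bar>" using lam(1) by (intro mult_left_mono) auto
      finally show ?thesis by (simp add: abs_minus_commute)
    qed
    then show "dist ((\<psi> \<circ> f \<circ> \<psi>') u) ((\<psi> \<circ> f \<circ> \<psi>') v) \<le> lam * dist u v"
      using xy by (simp add: dist_real_def x_def y_def)
  qed (use lam in simp)
  then show ?thesis using hom by blast
qed

section \<open>Topological entropy\<close>

text \<open>Two disjoint compact sets have positive distance. Phrased with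
  \<open>at_right 0\<close>, taking the minimum over finitely many pairs becomes a finite
  conjunction of eventual properties.\<close>

lemma compact_disjoint_gap:
  fixes K :: "'i \<Rightarrow> 'a::heine_borel set"
  assumes "finite S" and compact: "\<And>i. i \<in> S \<Longrightarrow> compact (K i)"
    and disj: "\<And>i j. i \<in> S \<Longrightarrow> j \<in> S \<Longrightarrow> i \<noteq> j \<Longrightarrow> K i \<inter> K j = {}"
  obtains e where "e > 0"
    "\<And>i j x y. i \<in> S \<Longrightarrow> j \<in> S \<Longrightarrow> i \<noteq> j \<Longrightarrow> x \<in> K i \<Longrightarrow> y \<in> K j \<Longrightarrow> e < dist x y"
proof -
  have "\<forall>\<^sub>F e in at_right 0. \<forall>x\<in>K i. \<forall>y\<in>K j. e < dist x y"
    if ij: "i \<in> S" "j \<in> S" "i \<noteq> j" for i j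
  proof -
    obtain d where "d > 0" "\<forall>x\<in>K i. \<forall>y\<in>K j. d \<le> dist x y"
      using separate_compact_closed[OF compact[OF ij(1)] compact_imp_closed[OF compact[OF ij(2)]]
          disj[OF ij]] by blast
    then show ?thesis
      unfolding eventually_at_right_field by (intro exI[of _ d]) force
  qed
  then have "\<forall>\<^sub>F e in at_right 0. \<forall>p\<in>S \<times> S. fst p \<noteq> snd p \<longrightarrow>
      (\<forall>x\<in>K (fst p). \<forall>y\<in>K (snd p). e < dist x y)"
    using \<open>finite S\<close> by (intro eventually_ball_finite) (auto intro: always_eventually)
  moreover have "\<forall>\<^sub>F e::real in at_right 0. 0 < e" by (rule eventually_at_right_less)
  ultimately have "\<forall>\<^sub>F e in at_right 0. (0 < e \<and> (\<forall>p\<in>S \<times> S. fst p \<noteq> snd p \<longrightarrow>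
      (\<forall>x\<in>K (fst p). \<forall>y\<in>K (snd p). e < dist x y)))"
    by eventually_elim blast
  then obtain e where "0 < e" "\<forall>p\<in>S \<times> S. fst p \<noteq> snd p \<longrightarrow>
      (\<forall>x\<in>K (fst p). \<forall>y\<in>K (snd p). e < dist x y)"
    using eventually_happens'[of "at_right (0::real)"] trivial_limit_at_right_real by blast
  then show ?thesis by (intro that[of e]) auto
qed

text \<open>Each word over \<open>S\<close> is the itinerary under \<open>f ^^ m\<close> of some
  point of \<open>D\<close>. Distinct words lead to points that are at some time in different sets
  \<open>K i\<close>, hence more than the gap \<open>e\<close> apart. So words of length
  \<open>l\<close> give \<open>card S ^ l\<close> separated orbits of length
  \<open>m * l\<close>.\<close>

lemma horseshoe_entropy:
  fixes f :: "'a::heine_borel \<Rightarrow> 'a"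
  assumes m: "m > 0" and S: "finite S" "S \<noteq> {}" and D: "D \<subseteq> X" "D \<noteq> {}"
    and compact: "\<And>i. i \<in> S \<Longrightarrow> compact (K i)" and KD: "\<And>i. i \<in> S \<Longrightarrow> K i \<subseteq> D"
    and cover: "\<And>i. i \<in> S \<Longrightarrow> D \<subseteq> (f ^^ m) ` K i"
    and disj: "\<And>i j. i \<in> S \<Longrightarrow> j \<in> S \<Longrightarrow> i \<noteq> j \<Longrightarrow> K i \<inter> K j = {}"
  shows "ereal (ln (real (card S)) / real m) \<le> topological_entropy X f"
proof -
  obtain e where e: "e > 0"
    "\<And>i j x y. i \<in> S \<Longrightarrow> j \<in> S \<Longrightarrow> i \<noteq> j \<Longrightarrow> x \<in> K i \<Longrightarrow> y \<in> K j \<Longrightarrow> e < dist x y"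
    using compact_disjoint_gap[of S K] S(1) compact disj by blast
  \<comment> \<open>Induction on the word: as \<open>f ^^ m\<close> maps \<open>K a\<close> over
    \<open>D\<close>, the point found for \<open>w\<close> has a preimage in \<open>K a\<close>, and
    this realises \<open>a # w\<close>.\<close>
  have "\<exists>x\<in>D. \<forall>i<length w. (f ^^ (m * i)) x \<in> K (w ! i)" if "set w \<subseteq> S" for w
    using that
  proof (induction w)
    case (Cons a w)
    then obtain z where z: "z \<in> D" "\<And>i. i < length w \<Longrightarrow> (f ^^ (m * i)) z \<in> K (w ! i)" by auto
    then obtain x where x: "x \<in> K a" "(f ^^ m) x = z" using cover[of a] Cons.prems by auto
    have "(f ^^ (m * i)) x \<in> K ((a # w) ! i)" if "i < length (a # w)" for i
    proof (cases i)
      case (Suc j)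
      have "(f ^^ (m * i)) x = (f ^^ (m * j)) ((f ^^ m) x)"
        unfolding Suc by (simp add: funpow_add add.commute[of m])
      then show ?thesis using z x Suc that by simp
    qed (use x in simp)
    then show ?case using x KD[of a] Cons.prems by auto
  qed (use D in auto)
  then obtain p where p: "\<And>w. set w \<subseteq> S \<Longrightarrow> p w \<in> D"
    "\<And>w i. set w \<subseteq> S \<Longrightarrow> i < length w \<Longrightarrow> (f ^^ (m * i)) (p w) \<in> K (w ! i)" by metis
  define u where "u n = (SUP E\<in>{E. finite E \<and> E \<noteq> {} \<and> E \<subseteq> X \<and> separated_set f n e E}.
      ereal (ln (real (card E)) / real n))" for n
  \<comment> \<open>Only positive multiples of \<open>m\<close> are considered: at
    \<open>n = 0\<close> division by zero gives the value 0, and the bound would fail.\<close>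
  have u_ge: "ereal (ln (real (card S)) / real m) \<le> u (m * Suc k)" for k
  proof -
    let ?W = "{w. set w \<subseteq> S \<and> length w = Suc k}"
    have sep: "\<exists>i<m * Suc k. e < dist ((f ^^ i) (p w)) ((f ^^ i) (p w'))"
      if w: "w \<in> ?W" "w' \<in> ?W" "w \<noteq> w'" for w w'
    proof -
      obtain i where i: "i < Suc k" "w ! i \<noteq> w' ! i" using w nth_equalityI[of w w'] by auto
      then have "w ! i \<in> S" "w' ! i \<in> S" using w nth_mem[of i w] nth_mem[of i w'] by auto
      then have "e < dist ((f ^^ (m * i)) (p w)) ((f ^^ (m * i)) (p w'))"
        using e(2) i p(2)[of w i] p(2)[of w' i] w by auto
      moreover have "m * i < m * Suc k" using i m by (intro mult_less_mono2)
      ultimately show ?thesis by blast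
    qed
    have inj: "inj_on p ?W"
      by (rule inj_onI, rule ccontr) (use sep e(1) in \<open>fastforce\<close>)
    have "p ` ?W \<in> {E. finite E \<and> E \<noteq> {} \<and> E \<subseteq> X \<and> separated_set f (m * Suc k) e E}"
    proof (intro CollectI conjI)
      show "finite (p ` ?W)" using S finite_lists_length_eq by blast
      obtain s where "s \<in> S" using S(2) by blast
      then have "replicate (Suc k) s \<in> ?W" by auto
      then show "p ` ?W \<noteq> {}" by blast
      show "p ` ?W \<subseteq> X" using p(1) D(1) by blast
      show "separated_set f (m * Suc k) e (p ` ?W)"
        unfolding separated_set_def
      proof (intro ballI impI)
        fix x y assume "x \<in> p ` ?W" "y \<in> p ` ?W" "x \<noteq> y"
        then obtain w w' where "w \<in> ?W" "w' \<in> ?W" "x = p w" "y = p w'" "w \<noteq> w'" by blast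
        then show "\<exists>i<m * Suc k. e < dist ((f ^^ i) x) ((f ^^ i) y)" using sep by blast
      qed
    qed
    then have "ereal (ln (real (card (p ` ?W))) / real (m * Suc k)) \<le> u (m * Suc k)"
      unfolding u_def by (rule SUP_upper)
    moreover have "card (p ` ?W) = card S ^ Suc k"
      using card_image[OF inj] card_lists_length_eq[OF S(1)] by simp
    moreover have "ln (real (card S ^ Suc k)) / real (m * Suc k) = ln (real (card S)) / real m"
    proof -
      have "0 < card S" using S by (simp add: card_gt_0_iff)
      then have "ln (real (card S ^ Suc k)) = real (Suc k) * ln (real (card S))"
        by (simp only: of_nat_power ln_realpow of_nat_0_less_iff)
      then have "ln (real (card S ^ Suc k)) / real (m * Suc k)
          = (real (Suc k) * ln (real (card S))) / (real (Suc k) * real m)"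
        by (simp only: of_nat_mult mult.commute[of "real m"])
      then show ?thesis by (simp del: of_nat_Suc)
    qed
    ultimately show ?thesis by simp
  qed
  have "ereal (ln (real (card S)) / real m) \<le> limsup (u \<circ> (\<lambda>k. m * Suc k))"
    by (rule le_Limsup) (use u_ge in auto)
  also have "\<dots> \<le> limsup u"
    by (rule limsup_subseq_mono) (use m in \<open>auto simp: strict_mono_Suc_iff\<close>)
  also have "\<dots> \<le> topological_entropy X f"
    unfolding topological_entropy_def u_def by (rule SUP_upper) (use e in auto)
  finally show ?thesis .
qed

text \<open>Singletons are separated and contribute \<open>ln 1 = 0\<close>. This excludes the value
  \<open>-\<infinity>\<close> in the final comparison.\<close>

lemma topological_entropy_nonneg:
  assumes "X \<noteq> {}" shows "0 \<le> topological_entropy X f"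
proof -
  obtain x where x: "x \<in> X" using assms by blast
  define u where "u n = (SUP E\<in>{E. finite E \<and> E \<noteq> {} \<and> E \<subseteq> X \<and> separated_set f n 1 E}.
      ereal (ln (real (card E)) / real n))" for n
  have "0 \<le> u n" for n
    unfolding u_def by (rule SUP_upper2[of "{x}"]) (use x in \<open>auto simp: separated_set_def\<close>)
  then have "0 \<le> limsup u" by (intro le_Limsup) auto
  also have "\<dots> \<le> topological_entropy X f"
    unfolding topological_entropy_def u_def by (rule SUP_upper) simp
  finally show ?thesis .
qed

text \<open>Choose \<open>d\<close> by uniform continuity of \<open>\<psi>'\<close>. Points that get
  \<open>e\<close> apart before time \<open>n\<close> have \<open>\<psi>\<close>-values at least
  \<open>d / L ^ n\<close> apart, since \<open>1 \<le> L\<close> makes \<open>L ^ n\<close> dominate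
  all earlier powers. Counting cells of that length bounds a separated set by a constant times
  \<open>L ^ n\<close>.\<close>

lemma entropy_le_lipschitz_conjugate:
  fixes f \<psi> :: "real \<Rightarrow> real"
  assumes self: "f ` {0..1} \<subseteq> {0..1}" and hom: "homeomorphism {0..1} {0..1} \<psi> \<psi>'"
    and lip: "L-lipschitz_on {0..1} (\<psi> \<circ> f \<circ> \<psi>')" and L: "1 \<le> L"
  shows "topological_entropy {0..1} f \<le> ereal (ln L)"
  unfolding topological_entropy_def
proof (rule SUP_least)
  fix e :: real assume "e \<in> {0<..}"
  then have e: "e > 0" by simp
  have \<psi>: "\<And>x. x \<in> {0..1} \<Longrightarrow> \<psi>' (\<psi> x) = x" "\<And>x. x \<in> {0..1} \<Longrightarrow> \<psi> x \<in> {0..1}"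
    using hom unfolding homeomorphism_def by auto
  have "uniformly_continuous_on {0..1} \<psi>'"
    using hom by (intro compact_uniformly_continuous) (auto simp: homeomorphism_def)
  then obtain d where d: "d > 0"
    "\<And>s t. s \<in> {0..1} \<Longrightarrow> t \<in> {0..1} \<Longrightarrow> dist s t < d \<Longrightarrow> dist (\<psi>' s) (\<psi>' t) < e"
    unfolding uniformly_continuous_on_def using e by metis
  have iter: "\<bar>\<psi> ((f ^^ n) x) - \<psi> ((f ^^ n) y)\<bar> \<le> L ^ n * \<bar>\<psi> x - \<psi> y\<bar>"
    if xy: "x \<in> {0..1}" "y \<in> {0..1}" for x y n
  proof (induction n)
    case (Suc n)
    let ?x = "(f ^^ n) x" and ?y = "(f ^^ n) y"
    have in01: "?x \<in> {0..1}" "?y \<in> {0..1}" using funpow_in[OF self] xy by auto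
    then have "\<bar>\<psi> (f ?x) - \<psi> (f ?y)\<bar> \<le> L * \<bar>\<psi> ?x - \<psi> ?y\<bar>"
      using lipschitz_onD[OF lip \<psi>(2) \<psi>(2)] \<psi>(1) by (simp add: dist_real_def)
    also have "\<dots> \<le> L * (L ^ n * \<bar>\<psi> x - \<psi> y\<bar>)" using Suc L by (intro mult_left_mono) auto
    finally show ?case by (simp add: mult.assoc)
  qed simp
  have card_le: "real (card E) \<le> (1 / d + 1) * L ^ n"
    if E: "finite E" "E \<subseteq> {0..1}" "separated_set f n e E" for E n
  proof -
    define q where "q x = \<lfloor>\<psi> x * L ^ n / d\<rfloor>" for x
    have "inj_on q E"
    proof (rule inj_onI, rule ccontr)
      fix x y assume xy: "x \<in> E" "y \<in> E" "q x = q y" "x \<noteq> y"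
      then obtain i where i: "i < n" "e < dist ((f ^^ i) x) ((f ^^ i) y)"
        using E(3) unfolding separated_set_def by blast
      have x01: "x \<in> {0..1}" "y \<in> {0..1}" using xy E by auto
      then have "(f ^^ i) x \<in> {0..1}" "(f ^^ i) y \<in> {0..1}" using funpow_in[OF self] by auto
      then have "d \<le> \<bar>\<psi> ((f ^^ i) x) - \<psi> ((f ^^ i) y)\<bar>"
        using d(2)[of "\<psi> ((f ^^ i) x)" "\<psi> ((f ^^ i) y)"] \<psi> i by (force simp: dist_real_def)
      also have "\<dots> \<le> L ^ i * \<bar>\<psi> x - \<psi> y\<bar>" using iter x01 by blast
      also have "\<dots> \<le> L ^ n * \<bar>\<psi> x - \<psi> y\<bar>"
        using L i by (intro mult_right_mono power_increasing) auto
      finally have "1 \<le> \<bar>\<psi> x * L ^ n / d - \<psi> y * L ^ n / d\<bar>"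
        using d L by (simp add: diff_divide_distrib[symmetric] left_diff_distrib[symmetric]
            abs_mult mult.commute)
      then show False using xy(3) unfolding q_def by linarith
    qed
    then have "card E = card (q ` E)" by (simp add: card_image)
    also have "\<dots> \<le> card {0..\<lfloor>L ^ n / d\<rfloor>}"
    proof (rule card_mono)
      show "q ` E \<subseteq> {0..\<lfloor>L ^ n / d\<rfloor>}"
      proof
        fix t assume "t \<in> q ` E"
        then obtain x where x: "x \<in> E" "t = q x" by blast
        then have "0 \<le> \<psi> x" "\<psi> x \<le> 1" using \<psi>(2)[of x] E by auto
        then have "0 \<le> \<psi> x * L ^ n / d" "\<psi> x * L ^ n / d \<le> 1 * L ^ n / d"
          using d L by (auto intro!: divide_right_mono mult_right_mono)
        then show "t \<in> {0..\<lfloor>L ^ n / d\<rfloor>}"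
          unfolding x q_def using floor_mono by auto
      qed
    qed simp
    also have "\<dots> = nat (\<lfloor>L ^ n / d\<rfloor> + 1)" by simp
    finally have "real (card E) \<le> real (nat (\<lfloor>L ^ n / d\<rfloor> + 1))" by linarith
    also have "\<dots> \<le> L ^ n / d + 1"
    proof -
      have "0 \<le> L ^ n / d" using d L by simp
      then show ?thesis by linarith
    qed
    also have "\<dots> \<le> L ^ n / d + L ^ n" using L by simp
    finally show ?thesis by (simp add: field_simps)
  qed
  have "limsup (\<lambda>n. SUP E\<in>{E. finite E \<and> E \<noteq> {} \<and> E \<subseteq> {0..1} \<and> separated_set f n e E}.
      ereal (ln (real (card E)) / real n)) \<le> limsup (\<lambda>n. ereal (ln (1 / d + 1) / real n + ln L))"
  proof (rule Limsup_mono, rule eventually_sequentiallyI[of 1], rule SUP_least)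
    fix n :: nat and E assume n: "1 \<le> n"
      and "E \<in> {E. finite E \<and> E \<noteq> {} \<and> E \<subseteq> {0..1} \<and> separated_set f n e E}"
    then have E: "finite E" "E \<noteq> {}" "E \<subseteq> {0..1}" "separated_set f n e E" by auto
    have "0 < real (card E)" using E by (simp add: card_gt_0_iff)
    then have "ln (real (card E)) \<le> ln ((1 / d + 1) * L ^ n)"
      using card_le[OF E(1,3,4)] by (intro ln_mono) auto
    also have "\<dots> = ln (1 / d + 1) + real n * ln L"
    proof -
      have "0 < 1 / d + 1" using d by (simp add: add_pos_pos)
      then show ?thesis using L by (simp add: ln_mult_pos ln_realpow)
    qed
    finally show "ereal (ln (real (card E)) / real n) \<le> ereal (ln (1 / d + 1) / real n + ln L)"
      using n by (simp add: field_simps)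
  qed
  also have "\<dots> = ereal (ln L)"
  proof (rule lim_imp_Limsup)
    have "(\<lambda>n. ln (1 / d + 1) / real n + ln L) \<longlonglongrightarrow> 0 + ln L"
      by (intro tendsto_add tendsto_const tendsto_divide_0[OF tendsto_const])
        (simp add: filterlim_real_sequentially filterlim_at_top_imp_at_infinity)
    then show "(\<lambda>n. ereal (ln (1 / d + 1) / real n + ln L)) \<longlonglongrightarrow> ereal (ln L)" by simp
  qed simp
  finally show "limsup (\<lambda>n. SUP E\<in>{E. finite E \<and> E \<noteq> {} \<and> E \<subseteq> {0..1} \<and> separated_set f n e E}.
      ereal (ln (real (card E)) / real n)) \<le> ereal (ln L)" .
qed

section \<open>Mixing maps of class \<open>C\<^sup>1\<close>\<close>

lemma openin_unit_interval_Ioo: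
  fixes u v :: real
  assumes "0 \<le> u" "v \<le> 1"
  shows "openin (top_of_set {0..1}) {u<..<v}"
  using assms by (intro open_subset) auto

lemma openin_unit_interval_contains_Ioo:
  fixes U :: "real set"
  assumes "openin (top_of_set {0..1}) U" "U \<noteq> {}"
  obtains u v where "0 \<le> u" "u < v" "v \<le> 1" "{u<..<v} \<subseteq> U"
proof -
  obtain x where x: "x \<in> U" using assms(2) by blast
  then obtain e where e: "e > 0" "ball x e \<inter> {0..1} \<subseteq> U"
    using assms(1) unfolding openin_contains_ball by blast
  have "x \<in> {0..1}" using assms(1) x openin_imp_subset by blast
  then show ?thesis
    using e by (intro that[of "max 0 (x - e)" "min 1 (x + e)"]) (auto simp: dist_real_def subset_iff)
qed

lemma mixingD:
  assumes "topologically_mixing f"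
    and "openin (top_of_set {0..1}) U" "U \<noteq> {}" "openin (top_of_set {0..1}) V" "V \<noteq> {}"
  shows "\<exists>n0. \<forall>n\<ge>n0. (f ^^ n) ` U \<inter> V \<noteq> {}"
  using assms unfolding topologically_mixing_def by blast

text \<open>The orbit of the open interval never leaves \<open>{s..t}\<close>, whose complement
  contains a nonempty open set.\<close>

lemma mixing_no_invariant_interval:
  fixes s t :: real
  assumes mix: "topologically_mixing f" and st: "0 \<le> s" "s < t" "t \<le> 1" "0 < s \<or> t < 1"
    and inv: "f ` {s..t} \<subseteq> {s..t}"
  shows False
proof -
  define V where "V = {0<..<s} \<union> {t<..<1}"
  have V: "openin (top_of_set {0..1}) V" "V \<noteq> {}"
    unfolding V_def using st by (auto intro!: openin_Un openin_unit_interval_Ioo)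
  have U: "openin (top_of_set {0..1}) {s<..<t}" "{s<..<t} \<noteq> {}"
    using st openin_unit_interval_Ioo by auto
  obtain n where "(f ^^ n) ` {s<..<t} \<inter> V \<noteq> {}"
    using mixingD[OF mix U V] by blast
  moreover have "(f ^^ n) ` {s<..<t} \<subseteq> {s..t}"
    using funpow_in[OF inv] by auto
  ultimately show False unfolding V_def by auto
qed

text \<open>The image is compact, so the points it misses form an open set that no iterate after the
  first step can visit.\<close>

lemma mixing_surj:
  fixes f :: "real \<Rightarrow> real"
  assumes mix: "topologically_mixing f" and cont: "continuous_on {0..1} f" and self: "f ` {0..1} \<subseteq> {0..1}"
  shows "f ` {0..1} = {0..1}"
proof (rule ccontr)
  assume "f ` {0..1} \<noteq> {0..1}"
  then have "{0..1} - f ` {0..1} \<noteq> {}" using self by blast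
  moreover have "compact (f ` {0..1})" using cont compact_continuous_image by blast
  then have "openin (top_of_set {0..1}) ({0..1} - f ` {0..1})"
    by (intro openin_diff) (auto intro!: closed_subset self compact_imp_closed)
  moreover have "openin (top_of_set {0..1}) {0..1::real}" "{0..1::real} \<noteq> {}" by auto
  ultimately obtain n0 where "\<forall>n\<ge>n0. (f ^^ n) ` {0..1} \<inter> ({0..1} - f ` {0..1}) \<noteq> {}"
    using mixingD[OF mix] by meson
  then have "(f ^^ Suc n0) ` {0..1} \<inter> ({0..1} - f ` {0..1}) \<noteq> {}" using le_SucI by blast
  moreover have "(f ^^ Suc n0) ` {0..1} \<subseteq> f ` {0..1}" using funpow_in[OF self] by auto
  ultimately show False by blast
qed

text \<open>An endpoint fixed by \<open>f\<close> that has no other preimage attracts if the slope there is less than 1;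
  otherwise \<open>f\<close> increases near it and pushes away a whole complementary interval. The \<open>C\<^sup>1\<close>
  hypothesis thus rules out folds accumulating at the endpoint.\<close>

lemma mixing_C1_endpoint_preimage:
  fixes f :: "real \<Rightarrow> real"
  assumes mix: "topologically_mixing f" and self: "f ` {0..1} \<subseteq> {0..1}" and C1: "C1_unit_interval f"
    and f0: "f 0 = 0" and pos: "\<And>x. 0 < x \<Longrightarrow> x \<le> 1 \<Longrightarrow> f x \<noteq> 0"
  shows False
proof -
  obtain f' where f': "continuous_on {0..1} f'"
    "\<And>x. x \<in> {0..1} \<Longrightarrow> (f has_real_derivative f' x) (at x within {0..1})"
    using C1 unfolding C1_unit_interval_def by blast
  have cont: "continuous_on {0..1} f"
    using f'(2) by (meson DERIV_continuous_on)
  have f01: "0 \<le> f x" "f x \<le> 1" if "0 \<le> x" "x \<le> 1" for x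
    using subsetD[OF self imageI, of x] that by auto
  show False
  proof (cases "f' 0 < 1")
    case True
    have "((\<lambda>y. (f y - f 0) / (y - 0)) \<longlongrightarrow> f' 0) (at 0 within {0..1})"
      using f'(2)[of 0] by (simp add: has_field_derivative_iff)
    then have "\<forall>\<^sub>F y in at 0 within {0..1}. (f y - f 0) / (y - 0) < 1"
      using True order_tendstoD(2) by blast
    then obtain d where d: "d > 0" "\<And>y. y \<in> {0..1} \<Longrightarrow> y \<noteq> 0 \<Longrightarrow> \<bar>y\<bar> < d \<Longrightarrow> f y / y < 1"
      unfolding eventually_at by (auto simp: f0 dist_real_def)
    define t where "t = min (d / 2) (1 / 2)"
    have t: "0 < t" "t < 1" "t < d" using d(1) unfolding t_def by auto
    have "f ` {0..t} \<subseteq> {0..t}"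
    proof clarify
      fix y assume y: "y \<in> {0..t}"
      have "f y \<le> y"
      proof (cases "y = 0")
        case False
        then show ?thesis using d(2)[of y] y t by (simp add: divide_less_eq_1)
      qed (simp add: f0)
      then show "f y \<in> {0..t}" using f01[of y] y t by auto
    qed
    then show False using mixing_no_invariant_interval[OF mix, of 0 t] t by auto
  next
    case False
    have "\<forall>\<^sub>F y in at 0 within {0..1}. 0 < f' y"
      using f'(1) False by (intro order_tendstoD(1)[of _ "f' 0"]) (auto simp: continuous_on_def)
    then obtain d where d: "d > 0" "\<And>y. y \<in> {0..1} \<Longrightarrow> y \<noteq> 0 \<Longrightarrow> \<bar>y\<bar> < d \<Longrightarrow> 0 < f' y"
      unfolding eventually_at by (auto simp: dist_real_def)
    define e where "e = min (d / 2) (1 / 2)"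
    have e: "0 < e" "e < 1" "e < d" using d(1) unfolding e_def by auto
    have inc: "f x < f y" if xy: "0 \<le> x" "x < y" "y \<le> e" for x y
    proof (rule DERIV_pos_imp_increasing_open[OF xy(2)])
      show "continuous_on {x..y} f" using xy e by (intro continuous_on_subset[OF cont]) auto
      fix z assume z: "x < z" "z < y"
      then have "(f has_real_derivative f' z) (at z)"
        using f'(2)[of z] xy e at_within_Icc_at[of 0 z 1] by auto
      moreover have "0 < f' z" using z xy e by (intro d(2)) auto
      ultimately show "\<exists>l. (f has_real_derivative l) (at z) \<and> 0 < l" by blast
    qed
    \<comment> \<open>If \<open>f x \<le> x\<close>, monotonicity near 0 would make
      \<open>{0..x}\<close> invariant.\<close>
    have gt: "x < f x" if x: "0 < x" "x \<le> e" for x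
    proof (rule ccontr)
      assume "\<not> x < f x"
      then have "f ` {0..x} \<subseteq> {0..x}"
        using inc[of _ x] x e f01 by (force simp: less_eq_real_def)
      then show False using mixing_no_invariant_interval[OF mix, of 0 x] x e by auto
    qed
    \<comment> \<open>By compactness \<open>f\<close> is bounded below on \<open>{e..1}\<close> by
      the positive value \<open>f w\<close>. Below \<open>e\<close> it moves points to the right, so
      \<open>{t..1}\<close> is invariant for \<open>t = min e (f w)\<close>.\<close>
    obtain w where w: "w \<in> {e..1}" "\<And>y. y \<in> {e..1} \<Longrightarrow> f w \<le> f y"
      using continuous_attains_inf[of "{e..1}" f] continuous_on_subset[OF cont, of "{e..1}"] e by auto
    have "0 < f w" using pos[of w] f01[of w] w(1) e by auto
    define t where "t = min e (f w)"
    have t: "0 < t" "t < 1" using \<open>0 < f w\<close> e unfolding t_def by auto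
    have "f ` {t..1} \<subseteq> {t..1}"
    proof clarify
      fix y assume y: "y \<in> {t..1}"
      have "t \<le> f y"
      proof (cases "y \<le> e")
        case True
        then show ?thesis using gt[of y] y t by auto
      next
        case False
        then have "f w \<le> f y" using w(2) y by auto
        then show ?thesis unfolding t_def by auto
      qed
      then show "f y \<in> {t..1}" using f01[of y] y t by auto
    qed
    then show False using mixing_no_invariant_interval[OF mix, of t 1] t by auto
  qed
qed

section \<open>Interior orbits reaching the endpoints, and the leo property\<close>

lemma C1_unit_interval_compose:
  assumes "C1_unit_interval f" "C1_unit_interval g" "g ` {0..1} \<subseteq> {0..1}"
  shows "C1_unit_interval (f \<circ> g)"
proof -
  obtain f' where f': "continuous_on {0..1} f'"
    "\<And>x. x \<in> {0..1} \<Longrightarrow> (f has_real_derivative f' x) (at x within {0..1})"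
    using assms(1) unfolding C1_unit_interval_def by blast
  obtain g' where g': "continuous_on {0..1} g'"
    "\<And>x. x \<in> {0..1} \<Longrightarrow> (g has_real_derivative g' x) (at x within {0..1})"
    using assms(2) unfolding C1_unit_interval_def by blast
  have contg: "continuous_on {0..1} g"
    using g'(2) by (meson DERIV_continuous_on)
  have "continuous_on {0..1} (\<lambda>x. f' (g x) * g' x)"
    using assms(3) by (intro continuous_intros g'(1) continuous_on_compose2[OF f'(1) contg])
  moreover have "(f \<circ> g has_real_derivative f' (g x) * g' x) (at x within {0..1})"
    if "x \<in> {0..1}" for x
  proof -
    have "g x \<in> {0..1}" using subsetD[OF assms(3) imageI] that .
    then show ?thesis
      using that by (intro DERIV_image_chain g'(2) has_field_derivative_subset[OF f'(2) assms(3)])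
  qed
  ultimately show ?thesis unfolding C1_unit_interval_def by blast
qed

lemma mixing_funpow:
  assumes "topologically_mixing f" "m > 0"
  shows "topologically_mixing (f ^^ m)"
  unfolding topologically_mixing_def
proof (intro allI impI)
  fix U V :: "real set"
  assume "openin (top_of_set {0..1}) U \<and> U \<noteq> {} \<and> openin (top_of_set {0..1}) V \<and> V \<noteq> {}"
  then obtain n0 where n0: "\<forall>n\<ge>n0. (f ^^ n) ` U \<inter> V \<noteq> {}"
    using mixingD[OF assms(1)] by blast
  have "(f ^^ (m * n)) ` U \<inter> V \<noteq> {}" if "n \<ge> n0" for n
  proof -
    have "n \<le> m * n" using assms(2) by simp
    then show ?thesis using n0 that le_trans by blast
  qed
  then show "\<exists>n0. \<forall>n\<ge>n0. ((f ^^ m) ^^ n) ` U \<inter> V \<noteq> {}" unfolding funpow_mult by blast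
qed

text \<open>Otherwise the preimages of 0, which exist by surjectivity, are endpoints. Then either 0
  is fixed with no other preimage, or \<open>f\<close> exchanges 0 and 1 and the same holds for
  \<open>f \<circ> f\<close>. Both cases contradict
  \<open>mixing_C1_endpoint_preimage\<close>.\<close>

lemma mixing_C1_interior_orbit_hits_0:
  fixes f :: "real \<Rightarrow> real"
  assumes mix: "topologically_mixing f" and self: "f ` {0..1} \<subseteq> {0..1}" and C1: "C1_unit_interval f"
  shows "\<exists>n. \<exists>x\<in>{0<..<1}. (f ^^ n) x = 0"
proof (rule ccontr)
  assume "\<not> ?thesis"
  then have no: "(f ^^ n) x \<noteq> 0" if "0 < x" "x < 1" for n x using that by auto
  have no1: "f x \<noteq> 0" and no2: "f (f x) \<noteq> 0" if "0 < x" "x < 1" for x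
    using no[OF that, of 1] no[OF that, of 2] by (auto simp: numeral_2_eq_2)
  have cont: "continuous_on {0..1} f"
    using C1 unfolding C1_unit_interval_def by (meson DERIV_continuous_on)
  have surj: "f ` {0..1} = {0..1}" using mixing_surj[OF mix cont self] .
  obtain z where z: "z \<in> {0..1}" "f z = 0" using surj by (metis (no_types, lifting) atLeastAtMost_iff imageE order_refl zero_le_one)
  obtain w where w: "w \<in> {0..1}" "f w = 1" using surj by (metis (no_types, lifting) atLeastAtMost_iff imageE order_refl zero_le_one)
  have z01: "z = 0 \<or> z = 1" using z no1[of z] by (cases "0 < z"; cases "z < 1") auto
  \<comment> \<open>If \<open>f 1 = 0\<close>, an interior preimage of 1 would reach 0 in two
    steps.\<close>
  have w01: "f 1 = 0 \<Longrightarrow> w = 0 \<or> w = 1" using w no2[of w] by (cases "0 < w"; cases "w < 1") auto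
  show False
  proof (cases "f 0 = 0")
    case True
    then have "f 1 \<noteq> 0" using w w01 by auto
    then show False using mixing_C1_endpoint_preimage[OF mix self C1 True] no1
      by (metis order_le_less)
  next
    case False
    then have f1: "f 1 = 0" using z01 z by auto
    then have f0: "f 0 = 1" using w01 w by auto
    have no3: "f x \<noteq> 1" if "0 < x" "x \<le> 1" for x using that f1 no2[of x] by (cases "x = 1") auto
    have eq: "f ^^ 2 = f \<circ> f" by (simp add: numeral_2_eq_2)
    show False
    proof (rule mixing_C1_endpoint_preimage[of "f \<circ> f"])
      show "topologically_mixing (f \<circ> f)" using mixing_funpow[OF mix, of 2] eq by simp
      show "C1_unit_interval (f \<circ> f)" using C1_unit_interval_compose[OF C1 C1 self] .
      show "(f \<circ> f) ` {0..1} \<subseteq> {0..1}" using self by (auto simp: image_subset_iff)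
      show "(f \<circ> f) 0 = 0" using f0 f1 by simp
      fix x :: real assume x: "0 < x" "x \<le> 1"
      have "0 \<le> f x" "f x \<le> 1" using subsetD[OF self imageI, of x] x by auto
      then show "(f \<circ> f) x \<noteq> 0" using no3[OF x] no1[of "f x"] False by (cases "f x = 0") auto
    qed
  qed
qed

text \<open>The reflection \<open>r\<close> is an involution exchanging the endpoints, and
  conjugation by it preserves all hypotheses.\<close>

lemma mixing_C1_interior_orbit_hits_1:
  fixes f :: "real \<Rightarrow> real"
  assumes mix: "topologically_mixing f" and self: "f ` {0..1} \<subseteq> {0..1}" and C1: "C1_unit_interval f"
  shows "\<exists>n. \<exists>x\<in>{0<..<1}. (f ^^ n) x = 1"
proof -
  define r :: "real \<Rightarrow> real" where "r x = 1 - x" for x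
  have r01: "r ` {0..1} \<subseteq> {0..1}" unfolding r_def by auto
  have rr: "r (r x) = x" for x unfolding r_def by simp
  define g where "g = r \<circ> f \<circ> r"
  have gn: "g ^^ n = r \<circ> (f ^^ n) \<circ> r" for n
    by (induction n) (auto simp: g_def rr fun_eq_iff)
  have "C1_unit_interval r"
    unfolding C1_unit_interval_def r_def
    by (rule exI[of _ "\<lambda>_. -1"]) (auto intro!: derivative_eq_intros)
  moreover have "(f \<circ> r) ` {0..1} \<subseteq> {0..1}" using self r01 by (auto simp: image_subset_iff)
  ultimately have "C1_unit_interval g"
    unfolding g_def comp_assoc by (intro C1_unit_interval_compose C1 r01)
  moreover have "g ` {0..1} \<subseteq> {0..1}" using self r01 unfolding g_def by (auto simp: image_subset_iff)
  moreover have "topologically_mixing g"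
    unfolding topologically_mixing_def
  proof (intro allI impI)
    fix U V :: "real set"
    assume UV: "openin (top_of_set {0..1}) U \<and> U \<noteq> {} \<and> openin (top_of_set {0..1}) V \<and> V \<noteq> {}"
    have r_open: "openin (top_of_set {0..1}) (r ` W)" if W: "openin (top_of_set {0..1}) W" for W
    proof -
      have "r ` W = {0..1} \<inter> r -` W"
      proof
        show "r ` W \<subseteq> {0..1} \<inter> r -` W"
        proof (rule image_subsetI)
          fix w assume w: "w \<in> W"
          then have "r w \<in> {0..1}" using openin_imp_subset[OF W] by (intro subsetD[OF r01 imageI]) blast
          then show "r w \<in> {0..1} \<inter> r -` W" using w rr[of w] by simp
        qed
        show "{0..1} \<inter> r -` W \<subseteq> r ` W" using rr by (metis IntD2 image_eqI subsetI vimageD)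
      qed
      moreover have "continuous_on {0..1} r" unfolding r_def by (intro continuous_intros)
      ultimately show ?thesis using continuous_openin_preimage[of "{0..1}" r "{0..1}" W] W r01
        by (simp add: image_subset_iff_funcset)
    qed
    have "openin (top_of_set {0..1}) (r ` U)" "r ` U \<noteq> {}" "openin (top_of_set {0..1}) (r ` V)" "r ` V \<noteq> {}"
      using UV r_open by auto
    then obtain n0 where n0: "\<forall>n\<ge>n0. (f ^^ n) ` (r ` U) \<inter> r ` V \<noteq> {}"
      using mixingD[OF mix] by blast
    have "(g ^^ n) ` U \<inter> V \<noteq> {}" if n: "n \<ge> n0" for n
    proof -
      obtain u v where "u \<in> U" "v \<in> V" "(f ^^ n) (r u) = r v" using n0 n by blast
      then have "(g ^^ n) u = v" by (simp add: gn rr)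
      then show ?thesis using \<open>u \<in> U\<close> \<open>v \<in> V\<close> by blast
    qed
    then show "\<exists>n0. \<forall>n\<ge>n0. (g ^^ n) ` U \<inter> V \<noteq> {}" by blast
  qed
  ultimately obtain n x where x: "x \<in> {0<..<1}" "(g ^^ n) x = 0"
    using mixing_C1_interior_orbit_hits_0 by blast
  then have "(f ^^ n) (r x) = 1" by (simp add: gn r_def)
  moreover have "r x \<in> {0<..<1}" using x by (simp add: r_def)
  ultimately show ?thesis by blast
qed

text \<open>At all late times the connected image of an interval meets both \<open>{0<..<?l}\<close>
  and \<open>{?h<..<1}\<close>, hence contains \<open>x\<close> and \<open>y\<close>. The orbits of
  these two points then bring 0 and 1 into one common iterate.\<close>

lemma mixing_C1_imp_leo:
  fixes f :: "real \<Rightarrow> real"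
  assumes mix: "topologically_mixing f" and self: "f ` {0..1} \<subseteq> {0..1}" and C1: "C1_unit_interval f"
  shows "leo f"
  unfolding leo_def
proof (intro allI impI, elim conjE)
  fix U :: "real set"
  assume U: "openin (top_of_set {0..1}) U" "U \<noteq> {}"
  obtain u v where uv: "0 \<le> u" "u < v" "v \<le> 1" "{u<..<v} \<subseteq> U"
    using openin_unit_interval_contains_Ioo[OF U] by blast
  have cont: "continuous_on {0..1} f"
    using C1 unfolding C1_unit_interval_def by (meson DERIV_continuous_on)
  obtain n x where x: "x \<in> {0<..<1}" "(f ^^ n) x = 0"
    using mixing_C1_interior_orbit_hits_0[OF assms] by blast
  obtain m y where y: "y \<in> {0<..<1}" "(f ^^ m) y = 1"
    using mixing_C1_interior_orbit_hits_1[OF assms] by blast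
  have I: "openin (top_of_set {0..1}) {u<..<v}" "{u<..<v} \<noteq> {}"
    using uv openin_unit_interval_Ioo by auto
  let ?l = "min x y" and ?h = "max x y"
  have V: "openin (top_of_set {0..1}) {0<..<?l}" "{0<..<?l} \<noteq> {}"
      "openin (top_of_set {0..1}) {?h<..<1}" "{?h<..<1} \<noteq> {}"
    using x y by (auto intro!: openin_unit_interval_Ioo)
  obtain k1 where k1: "\<And>k. k \<ge> k1 \<Longrightarrow> (f ^^ k) ` {u<..<v} \<inter> {0<..<?l} \<noteq> {}"
    using mixingD[OF mix I V(1,2)] by blast
  obtain k2 where k2: "\<And>k. k \<ge> k2 \<Longrightarrow> (f ^^ k) ` {u<..<v} \<inter> {?h<..<1} \<noteq> {}"
    using mixingD[OF mix I V(3,4)] by blast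
  have conn: "connected ((f ^^ k) ` {u<..<v})" for k
    by (intro connected_continuous_image continuous_on_subset[OF continuous_on_funpow[OF cont self]])
      (use uv in auto)
  have mem: "{?l..?h} \<subseteq> (f ^^ k) ` {u<..<v}" if "k \<ge> max k1 k2" for k
  proof -
    have k: "k1 \<le> k" "k2 \<le> k" using that by auto
    obtain s where s: "s \<in> (f ^^ k) ` {u<..<v} \<inter> {0<..<?l}" using k1[OF k(1)] by blast
    obtain t where t: "t \<in> (f ^^ k) ` {u<..<v} \<inter> {?h<..<1}" using k2[OF k(2)] by blast
    have "{s..t} \<subseteq> (f ^^ k) ` {u<..<v}" using connected_contains_Icc[OF conn] s t by blast
    moreover have "{?l..?h} \<subseteq> {s..t}" using s t by auto
    ultimately show ?thesis by blast
  qed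
  \<comment> \<open>From \<open>x\<close> to 0 takes \<open>n\<close> steps, from \<open>y\<close>
    to 1 takes \<open>m\<close>. Waiting the other delay first synchronises the two
    arrivals.\<close>
  define k where "k = max k1 k2 + n + m"
  have "0 \<in> (f ^^ k) ` {u<..<v}"
  proof -
    have "x \<in> (f ^^ (max k1 k2 + m)) ` {u<..<v}" using mem[of "max k1 k2 + m"] by auto
    then have "(f ^^ n) x \<in> (f ^^ n) ` (f ^^ (max k1 k2 + m)) ` {u<..<v}" by blast
    also have "\<dots> = (f ^^ k) ` {u<..<v}"
      unfolding image_comp funpow_add[symmetric] k_def by (simp add: ac_simps)
    finally show ?thesis using x by simp
  qed
  moreover have "1 \<in> (f ^^ k) ` {u<..<v}"
  proof -
    have "y \<in> (f ^^ (max k1 k2 + n)) ` {u<..<v}" using mem[of "max k1 k2 + n"] by auto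
    then have "(f ^^ m) y \<in> (f ^^ m) ` (f ^^ (max k1 k2 + n)) ` {u<..<v}" by blast
    also have "\<dots> = (f ^^ k) ` {u<..<v}"
      unfolding image_comp funpow_add[symmetric] k_def by (simp add: ac_simps)
    finally show ?thesis using y by simp
  qed
  ultimately have "{0..1} \<subseteq> (f ^^ k) ` U"
    using connected_contains_Icc[OF conn] uv(4) by (meson image_mono subset_trans)
  moreover have "(f ^^ k) ` U \<subseteq> {0..1}"
    using funpow_in[OF self] openin_imp_subset[OF U(1)] by blast
  ultimately show "\<exists>n. (f ^^ n) ` U = {0..1}" by blast
qed

section \<open>Markov branches\<close>

lemma closed_unit_interval_gap:
  fixes P :: "real set"
  assumes P: "closed P" "0 \<in> P" "1 \<in> P" and x: "x \<in> {0..1} - P"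
  obtains p q where "p \<in> P" "q \<in> P" "0 \<le> p" "p < x" "x < q" "q \<le> 1" "{p<..<q} \<inter> P = {}"
proof -
  have "compact (P \<inter> {0..x})" "P \<inter> {0..x} \<noteq> {}" using P x by (auto intro: closed_Int_compact)
  then obtain p where p: "p \<in> P \<inter> {0..x}" "\<And>t. t \<in> P \<inter> {0..x} \<Longrightarrow> t \<le> p"
    using compact_attains_sup by metis
  have "compact (P \<inter> {x..1})" "P \<inter> {x..1} \<noteq> {}" using P x by (auto intro: closed_Int_compact)
  then obtain q where q: "q \<in> P \<inter> {x..1}" "\<And>t. t \<in> P \<inter> {x..1} \<Longrightarrow> q \<le> t"
    using compact_attains_inf by metis
  have "x \<noteq> p" "x \<noteq> q" using p q x by auto
  moreover have "{p<..<q} \<inter> P = {}"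
  proof (rule ccontr)
    assume "{p<..<q} \<inter> P \<noteq> {}"
    then obtain t where "t \<in> P" "p < t" "t < q" by auto
    then show False using p(1) p(2)[of t] q(1) q(2)[of t] by (cases "t \<le> x") auto
  qed
  ultimately show ?thesis using p q by (intro that[of p q]) auto
qed

lemma mono_on_Icc_of_Ioo:
  fixes f :: "real \<Rightarrow> real"
  assumes mono: "mono_on {p<..<q} f" and cont: "continuous_on {p..q} f"
  shows "mono_on {p..q} f"
proof (rule mono_onI)
  fix s t assume st: "s \<in> {p..q}" "t \<in> {p..q}" "s \<le> t"
  show "f s \<le> f t"
  proof (cases "s = t")
    case False
    then have lt: "s < t" using st by simp
    \<comment> \<open>The midpoint lies inside the open interval, so on each half only one end has
      to be reached by continuity.\<close>
    define c where "c = (s + t) / 2"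
    have c: "s < c" "c < t" using lt unfolding c_def by auto
    have "f s \<le> f c"
    proof (rule continuous_le_on_closure[of "{s<..<c}" f s "f c"])
      show "continuous_on (closure {s<..<c}) f" using c st by (intro continuous_on_subset[OF cont]) auto
      show "f z \<le> f c" if "z \<in> {s<..<c}" for z
        using that c st by (intro mono_onD[OF mono]) auto
    qed (use c in auto)
    also have "f c \<le> f t"
    proof (rule continuous_ge_on_closure[of "{c<..<t}" f t "f c"])
      show "continuous_on (closure {c<..<t}) f" using c st by (intro continuous_on_subset[OF cont]) auto
      show "f c \<le> f z" if "z \<in> {c<..<t}" for z
        using that c st by (intro mono_onD[OF mono]) auto
    qed (use c in auto)
    finally show ?thesis .
  qed simp
qed

lemma mono_on_imp_strict_mono_on_Icc:
  fixes f :: "real \<Rightarrow> real"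
  assumes mono: "mono_on {p<..<q} f" and cont: "continuous_on {p..q} f"
    and nonconst: "\<And>s t. p \<le> s \<Longrightarrow> s < t \<Longrightarrow> t \<le> q \<Longrightarrow> \<exists>z\<in>{s<..<t}. f z \<noteq> f s"
  shows "strict_mono_on {p..q} f"
proof (rule strict_mono_onI)
  fix s t assume st: "s \<in> {p..q}" "t \<in> {p..q}" "s < t"
  obtain z where z: "s < z" "z < t" "f z \<noteq> f s" using nonconst[of s t] st by auto
  note m = mono_onD[OF mono_on_Icc_of_Ioo[OF mono cont]]
  have "f s \<le> f z" "f z \<le> f t" using z st by (auto intro!: m)
  then show "f s < f t" using z(3) by simp
qed

text \<open>Turns monotonicity on a component into strict monotonicity on a closed gap with ends in
  \<open>P\<close>, the form needed to pull intervals back. Decreasing maps are expressed through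
  \<open>- f\<close>, so that the increasing case serves both.\<close>

lemma monotone_gap:
  fixes f :: "real \<Rightarrow> real"
  assumes P: "closed P" "0 \<in> P" "1 \<in> P"
    and mono: "\<And>I. I \<in> components ({0..1} - P) \<Longrightarrow> mono_on I f \<or> antimono_on I f"
    and cont: "continuous_on {0..1} f"
    and nonconst: "\<And>s t. 0 \<le> s \<Longrightarrow> s < t \<Longrightarrow> t \<le> 1 \<Longrightarrow> \<exists>z\<in>{s<..<t}. f z \<noteq> f s"
    and x: "x \<in> {0..1} - P"
  obtains p q where "p \<in> P" "q \<in> P" "0 \<le> p" "p < x" "x < q" "q \<le> 1"
    "strict_mono_on {p..q} f \<or> strict_mono_on {p..q} (\<lambda>x. - f x)"
proof -
  obtain p q where pq: "p \<in> P" "q \<in> P" "0 \<le> p" "p < x" "x < q" "q \<le> 1" "{p<..<q} \<inter> P = {}"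
    using closed_unit_interval_gap[OF P x] by blast
  define I where "I = connected_component_set ({0..1} - P) x"
  have I: "I \<in> components ({0..1} - P)" unfolding I_def using x by (rule componentsI)
  have sub: "{p<..<q} \<subseteq> I"
    unfolding I_def using pq by (intro connected_component_maximal) auto
  have contpq: "continuous_on {p..q} f" using pq by (intro continuous_on_subset[OF cont]) auto
  have "strict_mono_on {p..q} f \<or> strict_mono_on {p..q} (\<lambda>x. - f x)"
    using mono[OF I]
  proof
    assume "mono_on I f"
    then have "mono_on {p<..<q} f" using sub by (rule monotone_on_subset)
    then show ?thesis
      using pq nonconst by (intro disjI1 mono_on_imp_strict_mono_on_Icc contpq) auto
  next
    assume "antimono_on I f"
    then have "antimono_on {p<..<q} f" using sub by (rule monotone_on_subset)
    then have "mono_on {p<..<q} (\<lambda>x. - f x)" by (auto simp: monotone_on_def)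
    then show ?thesis
      using pq nonconst by (intro disjI2 mono_on_imp_strict_mono_on_Icc continuous_intros contpq) auto
  qed
  then show ?thesis using pq that by blast
qed

text \<open>The end values \<open>f p\<close> and \<open>f q\<close> lie on either side of
  \<open>f x\<close> but outside the target, so the intermediate value theorem reaches both ends of
  the target within the gap.\<close>

lemma strict_mono_on_gap_branch:
  fixes f :: "real \<Rightarrow> real"
  assumes mono: "strict_mono_on {p..q} f" and cont: "continuous_on {p..q} f"
    and x: "p < x" "x < q" and fx: "u1 < f x" "f x < v1"
    and ends: "f p \<notin> {u1<..<v1}" "f q \<notin> {u1<..<v1}"
  obtains u v where "p \<le> u" "u < x" "x < v" "v \<le> q" "f u = u1" "f v = v1"
    "f ` {u<..<v} \<subseteq> {u1<..<v1}"
proof -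
  have "f p < f x" "f x < f q" using x by (auto intro!: strict_mono_onD[OF mono])
  then have "f p \<le> u1" "v1 \<le> f q" using ends fx by auto
  then obtain u v where uv: "p \<le> u" "u \<le> q" "f u = u1" "p \<le> v" "v \<le> q" "f v = v1"
    using IVT'[of f p u1 q] IVT'[of f p v1 q] cont x fx by auto
  have less: "s < t" if "s \<in> {p..q}" "t \<in> {p..q}" "f s < f t" for s t
    using strict_mono_onD[OF mono that(2,1)] that(3) by (cases s t rule: linorder_cases) auto
  have "f z \<in> {u1<..<v1}" if "z \<in> {u<..<v}" for z
    using strict_mono_onD[OF mono, of u z] strict_mono_onD[OF mono, of z v] that uv by auto
  then show ?thesis using uv less[of u x] less[of x v] x fx by (intro that[of u v]) auto
qed

text \<open>By induction, the branch of \<open>f ^^ n\<close> at \<open>f x\<close> is pulled back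
  along the gap containing \<open>x\<close>. Orbits starting in \<open>P\<close> stay there and
  never enter \<open>(a, b)\<close>, so the branch at \<open>f x\<close> contains no point of
  \<open>P\<close>. The gap ends, mapped into \<open>P\<close>, therefore cannot cut the pull-back
  short.\<close>

lemma Markov_branch:
  fixes f :: "real \<Rightarrow> real"
  assumes P: "f ` P \<subseteq> P" "a \<in> P" "b \<in> P" "{a<..<b} \<inter> P = {}"
    and ab: "0 \<le> a" "b \<le> 1"
    and cont: "continuous_on {0..1} f" and self: "f ` {0..1} \<subseteq> {0..1}"
    and gap: "\<And>x. x \<in> {0..1} - P \<Longrightarrow> \<exists>p q. p \<in> P \<and> q \<in> P \<and> 0 \<le> p \<and> p < x \<and> x < q \<and> q \<le> 1 \<and>
        (strict_mono_on {p..q} f \<or> strict_mono_on {p..q} (\<lambda>x. - f x))"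
    and x: "x \<in> {0..1}" "(f ^^ n) x \<in> {a<..<b}"
  shows "\<exists>u v. 0 \<le> u \<and> u < x \<and> x < v \<and> v \<le> 1 \<and> inj_on (f ^^ n) {u<..<v} \<and>
    (f ^^ n) ` {u<..<v} \<subseteq> {a<..<b} \<and>
    ((f ^^ n) u = a \<and> (f ^^ n) v = b \<or> (f ^^ n) u = b \<and> (f ^^ n) v = a)"
  using x
proof (induction n arbitrary: x)
  case 0
  then show ?case using ab by (intro exI[of _ a] exI[of _ b]) auto
next
  case (Suc n)
  have Suc_eq: "(f ^^ Suc n) z = (f ^^ n) (f z)" for z by (simp add: funpow_swap1)
  have "f x \<in> {0..1}" using subsetD[OF self imageI] Suc.prems(1) .
  moreover have "(f ^^ n) (f x) \<in> {a<..<b}" using Suc.prems(2) Suc_eq by simp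
  ultimately obtain u1 v1 where uv1: "0 \<le> u1" "u1 < f x" "f x < v1" "v1 \<le> 1"
    "inj_on (f ^^ n) {u1<..<v1}" "(f ^^ n) ` {u1<..<v1} \<subseteq> {a<..<b}"
    "(f ^^ n) u1 = a \<and> (f ^^ n) v1 = b \<or> (f ^^ n) u1 = b \<and> (f ^^ n) v1 = a"
    using Suc.IH by blast
  have noP: "z \<notin> P" if "z \<in> {u1<..<v1}" for z
    using uv1(6) that P(4) funpow_in[OF P(1), of z n] by blast
  have "x \<notin> P" using noP[of "f x"] uv1 P(1) by auto
  then obtain p q where pq: "p \<in> P" "q \<in> P" "0 \<le> p" "p < x" "x < q" "q \<le> 1"
    "strict_mono_on {p..q} f \<or> strict_mono_on {p..q} (\<lambda>x. - f x)"
    using gap[of x] Suc.prems(1) by blast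
  have contpq: "continuous_on {p..q} f" using pq by (intro continuous_on_subset[OF cont]) auto
  have ends: "f p \<notin> {u1<..<v1}" "f q \<notin> {u1<..<v1}" using noP P(1) pq by blast+
  have injf: "inj_on f {p..q}"
    using pq(7)
  proof
    assume "strict_mono_on {p..q} f" then show ?thesis by (rule strict_mono_on_imp_inj_on)
  next
    assume "strict_mono_on {p..q} (\<lambda>x. - f x)"
    then have "inj_on (\<lambda>x. - f x) {p..q}" by (rule strict_mono_on_imp_inj_on)
    then show ?thesis by (auto simp: inj_on_def)
  qed
  obtain u v where uv: "p \<le> u" "u < x" "x < v" "v \<le> q" "f ` {u<..<v} \<subseteq> {u1<..<v1}"
    "f u = u1 \<and> f v = v1 \<or> f u = v1 \<and> f v = u1"
    using pq(7)
  proof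
    assume m: "strict_mono_on {p..q} f"
    show ?thesis
      by (rule strict_mono_on_gap_branch[OF m contpq pq(4,5) uv1(2,3) ends]) (use that in blast)
  next
    \<comment> \<open>Changing sign turns the target into \<open>{- v1<..<- u1}\<close>, so
      \<open>f\<close> takes the two end values in the opposite order.\<close>
    assume m: "strict_mono_on {p..q} (\<lambda>x. - f x)"
    obtain u v where "p \<le> u" "u < x" "x < v" "v \<le> q" "- f u = - v1" "- f v = - u1"
      "(\<lambda>x. - f x) ` {u<..<v} \<subseteq> {- v1<..<- u1}"
      by (rule strict_mono_on_gap_branch[OF m continuous_on_minus[OF contpq] pq(4,5), of "- v1" "- u1"])
        (use uv1 ends in auto)
    then show ?thesis using that[of u v] by (auto simp: image_subset_iff)
  qed
  have "inj_on (f ^^ Suc n) {u<..<v}"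
    unfolding funpow_Suc_right
    using uv pq by (intro comp_inj_on inj_on_subset[OF injf] inj_on_subset[OF uv1(5)]) auto
  moreover have "(f ^^ Suc n) ` {u<..<v} \<subseteq> {a<..<b}"
    using uv(5) uv1(6) unfolding funpow_Suc_right image_comp[symmetric] by blast
  moreover have "(f ^^ Suc n) u = a \<and> (f ^^ Suc n) v = b \<or> (f ^^ Suc n) u = b \<and> (f ^^ Suc n) v = a"
    unfolding Suc_eq using uv(6) uv1(7) by auto
  moreover have "0 \<le> u" "v \<le> 1" using uv pq by auto
  ultimately show ?case using uv(2,3) by blast
qed

text \<open>The branches through distinct points of one fibre are disjoint, and \<open>f\<^sup>k\<close> spreads
  \<open>[c, d]\<close> over all of them, so that the fibre gives a horseshoe of \<open>f\<^sup>n\<^sup>+\<^sup>k\<close> in \<open>[c, d]\<close>.\<close>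

lemma fibre_entropy_bound:
  fixes f :: "real \<Rightarrow> real"
  assumes cont: "continuous_on {0..1} f" and self: "f ` {0..1} \<subseteq> {0..1}"
    and branch: "\<And>x. x \<in> {0..1} \<Longrightarrow> (f ^^ n) x \<in> {a<..<b} \<Longrightarrow>
      \<exists>u v. 0 \<le> u \<and> u < x \<and> x < v \<and> v \<le> 1 \<and> inj_on (f ^^ n) {u<..<v} \<and>
        (f ^^ n) ` {u<..<v} \<subseteq> {a<..<b} \<and>
        ((f ^^ n) u = a \<and> (f ^^ n) v = b \<or> (f ^^ n) u = b \<and> (f ^^ n) v = a)"
    and ab: "0 \<le> a" "b \<le> 1" and cd: "a < c" "c < d" "d < b" and k: "k > 0" "(f ^^ k) ` {c<..<d} = {0..1}"
    and y: "y \<in> {a<..<b}" and T: "finite T" "T \<noteq> {}" "T \<subseteq> {z \<in> {0..1}. (f ^^ n) z = y}"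
  shows "ereal (ln (real (card T)) / real (n + k)) \<le> topological_entropy {0..1} f"
proof -
  have contn: "continuous_on {0..1} (f ^^ j)" for j by (rule continuous_on_funpow[OF cont self])
  have "\<exists>u v. 0 \<le> u \<and> u < x \<and> x < v \<and> v \<le> 1 \<and> inj_on (f ^^ n) {u<..<v} \<and>
        (f ^^ n) ` {u<..<v} \<subseteq> {a<..<b} \<and>
        ((f ^^ n) u = a \<and> (f ^^ n) v = b \<or> (f ^^ n) u = b \<and> (f ^^ n) v = a)" if "x \<in> T" for x
    using branch[of x] that T(3) y by blast
  then obtain u v where uv: "\<And>x. x \<in> T \<Longrightarrow> 0 \<le> u x \<and> u x < x \<and> x < v x \<and> v x \<le> 1 \<and>
        inj_on (f ^^ n) {u x<..<v x} \<and> (f ^^ n) ` {u x<..<v x} \<subseteq> {a<..<b} \<and>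
        ((f ^^ n) (u x) = a \<and> (f ^^ n) (v x) = b \<or> (f ^^ n) (u x) = b \<and> (f ^^ n) (v x) = a)"
    by metis
  \<comment> \<open>Branch ends map to \<open>a\<close> or \<open>b\<close>, hence lie in no branch.
    Overlapping branches would thus coincide, and \<open>f ^^ n\<close> would fail to be injective
    there, as \<open>x\<close> and \<open>z\<close> have the same image.\<close>
  have disj_lt: "v x \<le> u z" if xz: "x \<in> T" "z \<in> T" "x < z" for x z
  proof (rule ccontr)
    assume overlap: "\<not> v x \<le> u z"
    have out: "t \<notin> {u s<..<v s}" if "s \<in> T" "(f ^^ n) t = a \<or> (f ^^ n) t = b" for s t
      using uv[OF that(1)] that(2) by fastforce
    have "u z \<notin> {u x<..<v x}" "v z \<notin> {u x<..<v x}" "u x \<notin> {u z<..<v z}" "v x \<notin> {u z<..<v z}"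
      using out uv xz by blast+
    then have "x \<in> {u z<..<v z}" using overlap uv[OF xz(1)] uv[OF xz(2)] xz(3) by auto
    moreover have "z \<in> {u z<..<v z}" using uv xz by auto
    moreover have "(f ^^ n) x = (f ^^ n) z" using xz T(3) by auto
    moreover have "inj_on (f ^^ n) {u z<..<v z}" using uv xz by blast
    ultimately have "x = z" using inj_onD by metis
    then show False using xz by simp
  qed
  \<comment> \<open>Adjacent branches may share an end. Restricting to values in
    \<open>{c..d}\<close>, inside \<open>(a, b)\<close>, gives closed sets that are truly disjoint;
    \<open>K\<close> transports them into \<open>{c..d}\<close> by \<open>f ^^ k\<close>.\<close>
  define J where "J x = {t \<in> {u x..v x}. (f ^^ n) t \<in> {c..d}}" for x
  define K where "K x = {w \<in> {c..d}. (f ^^ k) w \<in> J x}" for x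
  have J_sub: "J x \<subseteq> {u x<..<v x}" if "x \<in> T" for x
  proof
    fix t assume t: "t \<in> J x"
    then have "t \<noteq> u x" "t \<noteq> v x" using uv[OF that] cd unfolding J_def by auto
    then show "t \<in> {u x<..<v x}" using t unfolding J_def by auto
  qed
  have J_disj: "J x \<inter> J z = {}" if "x \<in> T" "z \<in> T" "x \<noteq> z" for x z
    using J_sub[OF that(1)] J_sub[OF that(2)] disj_lt[OF that(1,2)] disj_lt[OF that(2,1)] that(3)
    by (cases x z rule: linorder_cases) fastforce+
  have J_closed: "closed (J x)" if "x \<in> T" for x
  proof -
    have "continuous_on {u x..v x} (f ^^ n)" using uv[OF that] by (intro continuous_on_subset[OF contn]) auto
    then have "closed ({u x..v x} \<inter> (f ^^ n) -` {c..d})" by (intro continuous_closed_preimage) auto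
    moreover have "{u x..v x} \<inter> (f ^^ n) -` {c..d} = J x" unfolding J_def by auto
    ultimately show ?thesis by simp
  qed
  have contk: "continuous_on {c..d} (f ^^ k)" using cd ab by (intro continuous_on_subset[OF contn]) auto
  show ?thesis
  proof (rule horseshoe_entropy[where D = "{c..d}" and K = K])
    show "0 < n + k" using k by simp
    show "{c..d} \<subseteq> {0..1}" "{c..d} \<noteq> {}" using cd ab by auto
    fix x assume x: "x \<in> T"
    have "closed ({c..d} \<inter> (f ^^ k) -` J x)"
      using contk J_closed[OF x] by (intro continuous_closed_preimage) auto
    then have "compact ({c..d} \<inter> ({c..d} \<inter> (f ^^ k) -` J x))" by (intro compact_Int_closed) auto
    moreover have "{c..d} \<inter> ({c..d} \<inter> (f ^^ k) -` J x) = K x" unfolding K_def by auto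
    ultimately show "compact (K x)" by simp
    show "K x \<subseteq> {c..d}" unfolding K_def by auto
    show "{c..d} \<subseteq> (f ^^ (n + k)) ` K x"
    proof
      fix s assume s: "s \<in> {c..d}"
      have "connected ((f ^^ n) ` {u x..v x})"
        using uv[OF x] by (intro connected_continuous_image continuous_on_subset[OF contn]) auto
      moreover have "(f ^^ n) (u x) \<in> (f ^^ n) ` {u x..v x}" "(f ^^ n) (v x) \<in> (f ^^ n) ` {u x..v x}"
        using uv[OF x] by (auto intro!: imageI)
      then have "a \<in> (f ^^ n) ` {u x..v x}" "b \<in> (f ^^ n) ` {u x..v x}"
        using uv[OF x] by metis+
      ultimately have "{a..b} \<subseteq> (f ^^ n) ` {u x..v x}" by (rule connected_contains_Icc)
      moreover have "s \<in> {a..b}" using s cd by auto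
      ultimately obtain t where t: "t \<in> {u x..v x}" "(f ^^ n) t = s" by blast
      then have "t \<in> (f ^^ k) ` {c<..<d}" using uv[OF x] unfolding k(2) by auto
      then obtain w where w: "w \<in> {c<..<d}" "(f ^^ k) w = t" by blast
      then have "w \<in> K x" using t s unfolding K_def J_def by auto
      moreover have "(f ^^ (n + k)) w = s" using w t by (simp add: funpow_add)
      ultimately show "s \<in> (f ^^ (n + k)) ` K x" by blast
    qed
    fix z assume "z \<in> T" "x \<noteq> z"
    then show "K x \<inter> K z = {}" using J_disj[OF x] unfolding K_def by blast
  qed (use T in auto)
qed

text \<open>Fibres are not known to be finite in advance; the entropy bound on their finite subsets
  gives finiteness and the count together.\<close>

lemma card_bound_imp_finite:
  assumes "\<And>T. finite T \<Longrightarrow> T \<noteq> {} \<Longrightarrow> T \<subseteq> A \<Longrightarrow> real (card T) \<le> B" and "0 \<le> B"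
  shows "finite A \<and> real (card A) \<le> B"
proof
  show "finite A"
  proof (rule ccontr)
    assume "infinite A"
    then obtain T where "T \<subseteq> A" "finite T" "card T = Suc (nat \<lceil>B\<rceil>)"
      using infinite_arbitrarily_large by blast
    then show False using assms(1)[of T] by (cases "T = {}") (auto, linarith)
  qed
  then show "real (card A) \<le> B" using assms by (cases "A = {}") auto
qed

text \<open>Otherwise every iterate of the interval from the first on is a single point, which
  cannot meet two disjoint open sets at the same time.\<close>

lemma mixing_nonconstant:
  assumes mix: "topologically_mixing f" and st: "0 \<le> s" "s < t" "t \<le> 1"
  shows "\<exists>z\<in>{s<..<t}. f z \<noteq> f s"
proof (rule ccontr)
  assume "\<not> ?thesis"
  then have c: "f z = f s" if "z \<in> {s<..<t}" for z using that by blast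
  have U: "openin (top_of_set {0..1}) {s<..<t}" "{s<..<t} \<noteq> {}"
    using st openin_unit_interval_Ioo by auto
  have V: "openin (top_of_set {0..1}) {0<..<1/2::real}" "{0<..<1/2::real} \<noteq> {}"
    "openin (top_of_set {0..1}) {1/2<..<1::real}" "{1/2<..<1::real} \<noteq> {}"
    by (auto intro: openin_unit_interval_Ioo)
  obtain n1 where n1: "\<And>n. n \<ge> n1 \<Longrightarrow> (f ^^ n) ` {s<..<t} \<inter> {0<..<1/2} \<noteq> {}"
    using mixingD[OF mix U V(1,2)] by blast
  obtain n2 where n2: "\<And>n. n \<ge> n2 \<Longrightarrow> (f ^^ n) ` {s<..<t} \<inter> {1/2<..<1} \<noteq> {}"
    using mixingD[OF mix U V(3,4)] by blast
  define n where "n = n1 + n2"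
  have const: "(f ^^ Suc n) z = (f ^^ n) (f s)" if "z \<in> {s<..<t}" for z
    using c[OF that] by (simp add: funpow_swap1)
  obtain z1 where "z1 \<in> {s<..<t}" "(f ^^ Suc n) z1 \<in> {0<..<1/2}" using n1[of "Suc n"] n_def by fastforce
  moreover obtain z2 where "z2 \<in> {s<..<t}" "(f ^^ Suc n) z2 \<in> {1/2<..<1}"
    using n2[of "Suc n"] n_def by fastforce
  ultimately show False using const by fastforce
qed

section \<open>The two inequalities between \<open>Lip_inf\<close> and the exponential of the
  entropy\<close>

lemma leo_surj_iterate_of_open_interval:
  fixes f :: "real \<Rightarrow> real"
  assumes "leo f" "0 \<le> c" "c < d" "d \<le> 1"
  obtains k where "k > 0" "(f ^^ k) ` {c<..<d} = {0..1}"
proof -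
  have "openin (top_of_set {0..1}) {c<..<d}" "{c<..<d} \<noteq> {}"
    using assms openin_unit_interval_Ioo by auto
  then obtain k where k: "(f ^^ k) ` {c<..<d} = {0..1}" using assms(1) unfolding leo_def by blast
  \<comment> \<open>The case \<open>k = 0\<close> would identify \<open>{c<..<d}\<close> with the
    whole interval, but \<open>c\<close> is missing.\<close>
  have "c \<notin> {c<..<d}" "c \<in> {0..1}" using assms by auto
  then have "k \<noteq> 0" using k by (metis funpow_0 image_cong image_ident)
  then show ?thesis using that k by blast
qed

text \<open>A leo map is surjective, and so are its conjugates. A Lipschitz constant of such a
  conjugate is at least 1, as the entropy estimate requires.\<close>

lemma leo_Lip_inf_ge:
  fixes f :: "real \<Rightarrow> real"
  assumes leo: "leo f" and self: "f ` {0..1} \<subseteq> {0..1}"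
  shows "exp_ereal (topological_entropy {0..1} f) \<le> Lip_inf f"
  unfolding Lip_inf_def
proof (rule Inf_greatest, clarify)
  fix L and \<psi> \<psi>' :: "real \<Rightarrow> real"
  assume hom: "homeomorphism {0..1} {0..1} \<psi> \<psi>'" and lip: "L-lipschitz_on {0..1} (\<psi> \<circ> f \<circ> \<psi>')"
  obtain k where k: "k > 0" "(f ^^ k) ` {0<..<1} = {0..1}"
    using leo_surj_iterate_of_open_interval[OF leo, of 0 1] by auto
  have surj: "{0..1} \<subseteq> f ` {0..1}"
  proof
    fix y :: real assume "y \<in> {0..1}"
    then have "y \<in> (f ^^ k) ` {0<..<1}" unfolding k(2) .
    then obtain x where x: "x \<in> {0<..<1}" "(f ^^ k) x = y" by blast
    obtain j where "k = Suc j" using k(1) gr0_implies_Suc by blast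
    moreover have "(f ^^ j) x \<in> {0..1}" using x by (intro funpow_in[OF self]) auto
    ultimately show "y \<in> f ` {0..1}" using x by auto
  qed
  have \<psi>: "\<psi> ` {0..1} = {0..1}" "\<psi>' ` {0..1} = {0..1}" using hom unfolding homeomorphism_def by auto
  have "(\<psi> \<circ> f \<circ> \<psi>') ` {0..1} = {0..1}"
    by (simp only: image_comp[symmetric] \<psi> subset_antisym[OF self surj])
  moreover have "(0::real) \<in> {0..1}" "(1::real) \<in> {0..1}" by auto
  ultimately obtain s t where st: "s \<in> {0..1}" "t \<in> {0..1}" "(\<psi> \<circ> f \<circ> \<psi>') s = 0" "(\<psi> \<circ> f \<circ> \<psi>') t = 1"
    by (metis imageE)
  have "1 \<le> L * \<bar>s - t\<bar>"
    using lipschitz_onD[OF lip st(1,2)] unfolding st(3,4) by (simp add: dist_real_def)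
  also have "\<dots> \<le> L * 1"
    using st lipschitz_on_nonneg[OF lip] by (intro mult_left_mono) auto
  finally have L: "1 \<le> L" by simp
  have "topological_entropy {0..1} f \<le> ereal (ln L)"
    by (rule entropy_le_lipschitz_conjugate[OF self hom lip L])
  then show "exp_ereal (topological_entropy {0..1} f) \<le> ereal L"
  proof (cases "topological_entropy {0..1} f")
    case (real r)
    then have "exp r \<le> exp (ln L)" using \<open>topological_entropy {0..1} f \<le> ereal (ln L)\<close> by simp
    then show ?thesis using real L by simp
  qed (use L exp_ereal.simps(3) in auto)
qed

text \<open>Fibre counts of \<open>f ^^ n\<close> are at most \<open>exp (r * (n + k))\<close>, so
  every \<open>lam\<close> above \<open>exp r\<close> admits a \<open>lam\<close>-Lipschitz
  conjugate. The infimum follows by letting \<open>lam\<close> decrease to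
  \<open>exp r\<close>.\<close>

lemma leo_Markov_Lip_inf_le:
  fixes f :: "real \<Rightarrow> real"
  assumes cont: "continuous_on {0..1} f" and self: "f ` {0..1} \<subseteq> {0..1}"
    and mix: "topologically_mixing f" and leo: "leo f" and Markov: "countably_Markov f"
  shows "Lip_inf f \<le> exp_ereal (topological_entropy {0..1} f)"
proof -
  obtain P where P: "closed P" "countable P" "P \<subseteq> {0..1}" "0 \<in> P" "1 \<in> P" "f ` P \<subseteq> P"
    "\<And>I. I \<in> components ({0..1} - P) \<Longrightarrow> mono_on I f \<or> antimono_on I f"
    using Markov unfolding countably_Markov_def by blast
  have gap: "\<exists>p q. p \<in> P \<and> q \<in> P \<and> 0 \<le> p \<and> p < x \<and> x < q \<and> q \<le> 1 \<and>
      (strict_mono_on {p..q} f \<or> strict_mono_on {p..q} (\<lambda>x. - f x))" if "x \<in> {0..1} - P" for x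
    by (rule monotone_gap[OF P(1,4,5,7) cont mixing_nonconstant[OF mix] that]) blast+
  \<comment> \<open>Countability of \<open>P\<close> enters here: it leaves a point uncovered and
    hence a gap \<open>(a, b)\<close>.\<close>
  have "uncountable {0..1::real}" using uncountable_closed_interval[of 0 1] by simp
  then have "\<not> {0..1} \<subseteq> P" using countable_subset[OF _ P(2)] by metis
  then obtain x0 where "x0 \<in> {0..1} - P" by (meson DiffI subsetI)
  then obtain a b where ab: "a \<in> P" "b \<in> P" "0 \<le> a" "a < x0" "x0 < b" "b \<le> 1" "{a<..<b} \<inter> P = {}"
    using closed_unit_interval_gap[OF P(1,4,5)] by metis
  define c d where "c = (a + x0) / 2" and "d = (x0 + b) / 2"
  have cd: "a < c" "c < d" "d < b" using ab unfolding c_def d_def by auto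
  \<comment> \<open>This \<open>k\<close> is fixed before \<open>n\<close>, so it only contributes
    the constant factor \<open>exp (r * k)\<close> to a geometric series.\<close>
  obtain k where k: "k > 0" "(f ^^ k) ` {c<..<d} = {0..1}"
    using leo_surj_iterate_of_open_interval[OF leo, of c d] cd ab by auto
  have fibre: "ereal (ln (real (card T)) / real (n + k)) \<le> topological_entropy {0..1} f"
    if "y \<in> {a<..<b}" "finite T" "T \<noteq> {}" "T \<subseteq> {z \<in> {0..1}. (f ^^ n) z = y}" for n y T
    by (rule fibre_entropy_bound[OF cont self Markov_branch[OF P(6) ab(1,2,7,3,6) cont self gap]
          ab(3,6) cd k that])
  show ?thesis
  proof (cases "topological_entropy {0..1} f")
    case (real r)
    have fin: "finite {z \<in> {0..1}. (f ^^ n) z = y} \<and>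
        real (card {z \<in> {0..1}. (f ^^ n) z = y}) \<le> exp (r * real (n + k))"
      if y: "y \<in> {a<..<b}" for n y
    proof (rule card_bound_imp_finite)
      fix T assume T: "finite T" "T \<noteq> {}" "T \<subseteq> {z \<in> {0..1}. (f ^^ n) z = y}"
      have "ln (real (card T)) / real (n + k) \<le> r"
        using fibre[OF y T] real by simp
      then have "ln (real (card T)) \<le> r * real (n + k)"
        using k(1) by (simp add: divide_le_eq)
      moreover have "0 < real (card T)" using T by (simp add: card_gt_0_iff)
      ultimately show "real (card T) \<le> exp (r * real (n + k))" by (metis exp_le_cancel_iff exp_ln)
    qed simp
    have "Lip_inf f \<le> ereal (exp r) + ereal e" if e: "0 < e" for e
    proof -
      define lam where "lam = exp r + e"
      have lam: "exp r < lam" "0 < lam" using e unfolding lam_def by (auto simp: add_pos_pos)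
      have "exp (r * real (n + k)) / lam ^ n = exp (r * real k) * (exp r / lam) ^ n" for n
        by (simp add: distrib_left exp_add power_divide exp_of_nat2_mult mult.commute)
      moreover have "summable (\<lambda>n. exp (r * real k) * (exp r / lam) ^ n)"
        using lam by (intro summable_mult summable_geometric) simp
      ultimately have summ: "summable (\<lambda>n. exp (r * real (n + k)) / lam ^ n)" by simp
      have cover: "\<exists>n. {a<..<b} \<subseteq> (f ^^ n) ` {x..x'}" if x: "0 \<le> x" "x < x'" "x' \<le> 1" for x x'
      proof -
        obtain n where "(f ^^ n) ` {x<..<x'} = {0..1}"
          using leo_surj_iterate_of_open_interval[OF leo x] by blast
        moreover have "(f ^^ n) ` {x<..<x'} \<subseteq> (f ^^ n) ` {x..x'}" by (intro image_mono) auto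
        moreover have "{a<..<b} \<subseteq> {0..1}" using ab by auto
        ultimately have "{a<..<b} \<subseteq> (f ^^ n) ` {x..x'}" by simp
        then show ?thesis ..
      qed
      have "\<exists>\<psi> \<psi>'. homeomorphism {0..1} {0..1::real} \<psi> \<psi>' \<and>
          lam-lipschitz_on {0..1::real} (\<psi> \<circ> f \<circ> \<psi>')"
        using fin ab by (intro lipschitz_conjugate[OF cont self _ _ _ lam(2) summ cover])
          (auto simp: fibre_count_def)
      then have "Lip_inf f \<le> ereal lam" unfolding Lip_inf_def by (intro Inf_lower) blast
      then show ?thesis unfolding lam_def by simp
    qed
    then have "Lip_inf f \<le> ereal (exp r)" using ereal_le_epsilon2 by blast
    then show ?thesis using real by simp
  qed (use topological_entropy_nonneg[of "{0..1::real}" f] exp_ereal.simps(2) in auto)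
qed

theorem corollary4p16:
  fixes f :: "real \<Rightarrow> real"
  assumes "f ` {0..1} \<subseteq> {0..1}"
    and "C1_unit_interval f"
    and "topologically_mixing f"
    and "countably_Markov f"
  shows "leo f \<and> Lip_inf f = exp_ereal (topological_entropy {0..1} f)"
proof -
  have leo: "leo f" using mixing_C1_imp_leo assms by blast
  have "continuous_on {0..1} f"
    using assms(2) unfolding C1_unit_interval_def by (meson DERIV_continuous_on)
  then show ?thesis
    using leo leo_Lip_inf_ge[OF leo assms(1)] leo_Markov_Lip_inf_le[OF _ assms(1,3) leo assms(4)]
    by (simp add: order_antisym)
qed

end
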